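(* Fix $d\ge1$. For all partitions $\mu\subseteq\lambda$ with $\ell(\lambda)\le d$ (set $\lambda_i=0$ for $i>\ell(\lambda)$), as rational functions in $\beta$, $$\sum_{T\in\operatorname{SIT}(\lambda/\mu)}\prod_{k=1}^{m(T)}\left(\left[\prod_{i=1}^d\frac{1+\beta\big(\nu_i(T_{<k})+d-i+1\big)}{1+\beta(\lambda_i+d-i+1)}\right]-1\right)^{-1} =\prod_{i=1}^d\big(1+\beta(\lambda_i+d-i+1)\big)^{\lambda_i}\sum_{T\in\operatorname{SSVT}_d(\mu)}(-\beta)^{\operatorname{ne}(T)-|\lambda|}\prod_{(i,j)\in\mu,\ r\in T(i,j)}\frac{\lambda_{d+1-r}+i-j}{1+\beta(\lambda_{d+1-r}+r)}\prod_{(i,j)\in\lambda}\frac{1}{h(i,j)}.$$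
   Context: Partitions are identified with Young diagrams $\{(i,j):1\le j\le\lambda_i\}$ (English convention); $h(i,j)=\lambda_i-j+\lambda'_j-i+1$ is the hook length in $\lambda$ ($\lambda'$ conjugate), $|\cdot|$ counts cells. A standard increasing tableau of shape $\lambda/\mu$ is a filling $T$ of the cells of $\lambda/\mu$ by positive integers, strictly increasing along rows and down columns, with set of entries $\{1,\dots,m\}$ for some $m=m(T)$; $\operatorname{SIT}(\lambda/\mu)$ is their set; $\nu(T_{<k})$ is the partition whose diagram is $\mu$ together with the cells of $\lambda/\mu$ with entry $<k$, with parts $\nu_i(T_{<k})$. $\operatorname{SSVT}_d(\mu)$ is the set of semistandard set-valued tableaux of shape $\mu$ with entries in $\{1,\dots,d\}$: assignments of a nonempty subset $T(u)\subseteq\{1,\dots,d\}$ to each cell $u$ of $\mu$ such that $\max T(u)\le\min T(u')$ when $u'$ is immediately right of $u$, and $\max T(u)<\min T(u')$ when $u'$ is immediately below $u$. $\operatorname{ne}(T)=\sum_u|T(u)|$ is the number of entries. *)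

theory Defs
  imports "HOL-Computational_Algebra.Polynomial" "HOL-Computational_Algebra.Fraction_Field"
begin

definition is_partition :: "nat list \<Rightarrow> bool" where
  "is_partition lam \<longleftrightarrow> sorted_wrt (\<ge>) lam \<and> 0 \<notin> set lam"

definition part :: "nat list \<Rightarrow> nat \<Rightarrow> nat" where
  "part lam i = (if 1 \<le> i \<and> i \<le> length lam then lam ! (i - 1) else 0)"

definition diagram :: "nat list \<Rightarrow> (nat \<times> nat) set" where
  "diagram lam = {(i, j). 1 \<le> i \<and> 1 \<le> j \<and> j \<le> part lam i}"

definition size_part :: "nat list \<Rightarrow> nat" where
  "size_part lam = card (diagram lam)"

definition conj_part :: "nat list \<Rightarrow> nat \<Rightarrow> nat" where
  "conj_part lam j = card {i. 1 \<le> i \<and> j \<le> part lam i}"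

definition hook :: "nat list \<Rightarrow> nat \<times> nat \<Rightarrow> int" where
  "hook lam c = (case c of (i, j) \<Rightarrow>
     int (part lam i) - int j + int (conj_part lam j) - int i + 1)"

definition SIT :: "nat list \<Rightarrow> nat list \<Rightarrow> (nat \<times> nat \<Rightarrow> nat) set" where
  "SIT lam mu = {T.
     (\<forall>c. c \<notin> diagram lam - diagram mu \<longrightarrow> T c = 0) \<and>
     (\<forall>i j. (i, j) \<in> diagram lam - diagram mu \<and> (i, Suc j) \<in> diagram lam - diagram mu
            \<longrightarrow> T (i, j) < T (i, Suc j)) \<and>
     (\<forall>i j. (i, j) \<in> diagram lam - diagram mu \<and> (Suc i, j) \<in> diagram lam - diagram mu
            \<longrightarrow> T (i, j) < T (Suc i, j)) \<and>
     (\<exists>m. T ` (diagram lam - diagram mu) = {1..m})}"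

text \<open>m(T): the largest entry (entries are exactly {1..m(T)}).\<close>
definition sit_max :: "nat list \<Rightarrow> nat list \<Rightarrow> (nat \<times> nat \<Rightarrow> nat) \<Rightarrow> nat" where
  "sit_max lam mu T = card (T ` (diagram lam - diagram mu))"

definition nu_part :: "nat list \<Rightarrow> nat list \<Rightarrow> (nat \<times> nat \<Rightarrow> nat) \<Rightarrow> nat \<Rightarrow> nat \<Rightarrow> nat" where
  "nu_part lam mu T k i =
     card {j. (i, j) \<in> diagram mu \<or> ((i, j) \<in> diagram lam - diagram mu \<and> T (i, j) < k)}"

definition SSVT :: "nat \<Rightarrow> nat list \<Rightarrow> (nat \<times> nat \<Rightarrow> nat set) set" where
  "SSVT d mu = {S.
     (\<forall>c. c \<notin> diagram mu \<longrightarrow> S c = {}) \<and>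
     (\<forall>c \<in> diagram mu. S c \<noteq> {} \<and> S c \<subseteq> {1..d}) \<and>
     (\<forall>i j. (i, j) \<in> diagram mu \<and> (i, Suc j) \<in> diagram mu
            \<longrightarrow> Max (S (i, j)) \<le> Min (S (i, Suc j))) \<and>
     (\<forall>i j. (i, j) \<in> diagram mu \<and> (Suc i, j) \<in> diagram mu
            \<longrightarrow> Max (S (i, j)) < Min (S (Suc i, j)))}"

definition num_entries :: "nat list \<Rightarrow> (nat \<times> nat \<Rightarrow> nat set) \<Rightarrow> nat" where
  "num_entries mu S = (\<Sum>c \<in> diagram mu. card (S c))"

definition beta :: "rat poly fract" where
  "beta = Fract [:0, 1:] 1"

end

theory Submission
  imports Defs "HOL-Library.FuncSet"
begin

text \<open>Both sides satisfy the same recursion in \<open>\<mu>\<close>. Let \<open>G\<^sub>\<mu>(x | a)\<close> be the factorial Grothendieck polynomial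
  and put \<open>X\<^sub>r = 1 + \<beta> x\<^sub>r\<close>, \<open>A\<^sub>k = 1 + \<beta> a\<^sub>k\<close>, so that \<open>\<beta> (x\<^sub>r \<oplus> a\<^sub>k) = X\<^sub>r A\<^sub>k - 1\<close>. The Pieri rule
  \<open>G\<^sub>\<mu> \<Prod>\<^sub>i X\<^sub>i A(\<mu>\<^sub>i + d - i + 1) = \<Sum>\<^sub>\<nu> G\<^sub>\<nu>\<close> (powers of \<open>\<beta>\<close> absorbed), with \<open>\<nu>/\<mu>\<close> ranging over rook strips,
  is proved by induction on the number of variables: expanding both sides by the branching rule for the
  largest entry, the coefficients of \<open>G\<^sub>\<rho>\<close> agree because both factor over the rows and the factors match up to
  a telescoping correction. At the point \<open>X\<^sub>r = 1 / A(\<lambda>(d + 1 - r) + r)\<close> all \<open>G\<^sub>\<nu>\<close> with \<open>\<nu>\<close> not contained in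
  \<open>\<lambda>\<close> vanish and \<open>G\<^sub>\<lambda>\<close> is a product of hook lengths, so the Pieri rule becomes the recursion obtained
  by removing the entries 1 from a standard increasing tableau.\<close>

subsection \<open>Set-valued tableaux and the branching rule\<close>

text \<open>All powers of \<open>\<beta>\<close> are absorbed into \<open>X\<close> and
  \<open>A\<close>, so the Pieri rule is an identity for arbitrary nonzero \<open>A k\<close> in a
  field. The choice \<open>A k = 1 + \<beta> k\<close> enters at the end, where
  \<open>A x / A y - 1 = \<beta> (x - y) / A y\<close> produces the hooks and the linear factors.
  The obstacle in the induction is that neighbouring rows are coupled. A rook strip bounds part i +
  1 of \<open>\<nu>\<close> by part i of the old shape \<open>\<mu>\<close>, not of
  \<open>\<nu>\<close>; for fixed \<open>\<mu>\<close> and \<open>\<rho>\<close> the conditions on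
  the intermediate shape therefore separate by rows, and both coefficients become products. The
  factors of a single row still disagree when \<open>\<rho>\<close> is longer than
  \<open>\<mu>\<close> in that row or the next, which is what the correction repairs. The evaluation
  point solves \<open>X A = 1\<close>, which kills chosen weights and turns the Pieri factor into
  the ratio of the statement. The summand \<open>\<nu> = \<mu>\<close> accounts for the
  \<open>- 1\<close> there. Inverting requires a ratio different from 1 whenever
  \<open>\<mu> \<noteq> \<lambda>\<close>; it is below 1, because \<open>\<beta>\<close> is positive
  in the ordered field of rational functions.\<close>

text \<open>A shape with at most \<open>d\<close> rows is a function on \<open>{1..d}\<close>; values elsewhere are irrelevant.\<close>

definition cells :: "nat \<Rightarrow> (nat \<Rightarrow> nat) \<Rightarrow> (nat \<times> nat) set" where
  "cells d m = (SIGMA i:{1..d}. {1..m i})"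

definition dec :: "nat \<Rightarrow> (nat \<Rightarrow> nat) \<Rightarrow> bool" where
  "dec d m \<longleftrightarrow> (\<forall>i. 1 \<le> i \<longrightarrow> i < d \<longrightarrow> m (Suc i) \<le> m i)"

definition svt :: "nat \<Rightarrow> (nat \<Rightarrow> nat) \<Rightarrow> (nat \<times> nat \<Rightarrow> nat set) set" where
  "svt d m = {S. (\<forall>c. S c \<subseteq> {1..d}) \<and> (\<forall>c. S c \<noteq> {} \<longleftrightarrow> c \<in> cells d m)
     \<and> (\<forall>i j a b. a \<in> S (i, j) \<longrightarrow> b \<in> S (i, Suc j) \<longrightarrow> a \<le> b)
     \<and> (\<forall>i j a b. a \<in> S (i, j) \<longrightarrow> b \<in> S (Suc i, j) \<longrightarrow> a < b)}"

definition cell_weight ::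
    "(nat \<Rightarrow> 'a::field) \<Rightarrow> (int \<Rightarrow> 'a) \<Rightarrow> nat \<Rightarrow> nat \<times> nat \<Rightarrow> 'a" where
  "cell_weight X A r c = X r * A (int r + int (snd c) - int (fst c)) - 1"

definition groth :: "(nat \<Rightarrow> 'a::field) \<Rightarrow> (int \<Rightarrow> 'a) \<Rightarrow> nat \<Rightarrow> (nat \<Rightarrow> nat) \<Rightarrow> 'a" where
  "groth X A d m = (\<Sum>S\<in>svt d m. \<Prod>c\<in>cells d m. \<Prod>r\<in>S c. cell_weight X A r c)"

text \<open>Removing the entries \<open>D\<close> from a tableau shrinks row \<open>i\<close> from \<open>n\<close> to \<open>k\<close> cells and contributes
  \<open>strip_weight\<close>. The last remaining cell of row \<open>i\<close> may also contain \<open>D\<close>, provided no cell lies below it;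
  \<open>end_weight\<close> (whose \<open>n\<close> is the length of row \<open>i + 1\<close>) sums over both possibilities, \<open>1 + (X A - 1) = X A\<close>.\<close>

definition strip_weight ::
    "(nat \<Rightarrow> 'a::field) \<Rightarrow> (int \<Rightarrow> 'a) \<Rightarrow> nat \<Rightarrow> nat \<Rightarrow> nat \<Rightarrow> nat \<Rightarrow> 'a" where
  "strip_weight X A D i n k =
     (if k \<le> n then \<Prod>j\<in>{k<..n}. X D * A (int D + int j - int i) - 1 else 0)"

definition end_weight ::
    "(nat \<Rightarrow> 'a::field) \<Rightarrow> (int \<Rightarrow> 'a) \<Rightarrow> nat \<Rightarrow> nat \<Rightarrow> nat \<Rightarrow> nat \<Rightarrow> 'a" where
  "end_weight X A D i k n =
     (if n < k then X D * A (int D + int k - int i) else if n = k then 1 else 0)"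

lemma mem_cells [simp]: "(i, j) \<in> cells d m \<longleftrightarrow> 1 \<le> i \<and> i \<le> d \<and> 1 \<le> j \<and> j \<le> m i"
  by (auto simp: cells_def)

lemma finite_cells [simp]: "finite (cells d m)"
  by (simp add: cells_def)

lemma decD: "dec d m \<Longrightarrow> 1 \<le> i \<Longrightarrow> i < d \<Longrightarrow> m (Suc i) \<le> m i"
  by (simp add: dec_def)

lemma svtD:
  assumes "S \<in> svt d m"
  shows "a \<in> S c \<Longrightarrow> 1 \<le> a" "a \<in> S c \<Longrightarrow> a \<le> d" "S c \<noteq> {} \<longleftrightarrow> c \<in> cells d m"
    "a \<in> S (i, j) \<Longrightarrow> b \<in> S (i, Suc j) \<Longrightarrow> a \<le> b"
    "a \<in> S (i, j) \<Longrightarrow> b \<in> S (Suc i, j) \<Longrightarrow> a < b"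
proof -
  note S = assms[unfolded svt_def mem_Collect_eq]
  show "a \<in> S c \<Longrightarrow> 1 \<le> a" "a \<in> S c \<Longrightarrow> a \<le> d"
    using conjunct1[OF S] by (meson atLeastAtMost_iff subsetD)+
qed (use assms in \<open>unfold svt_def, blast\<close>)+

lemma svt_cell:
  assumes "S \<in> svt d m" "a \<in> S (i, j)"
  shows "1 \<le> i" "i \<le> d" "1 \<le> j" "j \<le> m i"
  using svtD(3)[OF assms(1), of "(i, j)"] assms(2) by auto

lemma finite_svt [simp]: "finite (svt d m)"
proof (rule finite_subset)
  show "svt d m \<subseteq> {S. S ` cells d m \<subseteq> Pow {1..d} \<and> {c. S c \<noteq> {}} \<subseteq> cells d m}"
    unfolding svt_def by blast
  have "finite {S. (\<forall>x. (x \<in> cells d m \<longrightarrow> S x \<in> Pow {1..d}) \<and> (x \<notin> cells d m \<longrightarrow> S x = {}))}"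
    by (rule finite_set_of_finite_funs) auto
  then show "finite {S. S ` cells d m \<subseteq> Pow {1..d} \<and> {c. S c \<noteq> {}} \<subseteq> cells d m}"
    by (rule rev_finite_subset) blast
qed

text \<open>The cells above an entry in its column hold strictly smaller positive entries. This
  confines row d + 1 of a tableau with entries up to d + 1 to the single entry d + 1, so removing
  that entry leaves at most d rows.\<close>

lemma row_le_entry:
  assumes S: "S \<in> svt d m" and m: "dec d m"
  shows "a \<in> S (i, j) \<Longrightarrow> i \<le> a"
proof (induction i arbitrary: a)
  case 0
  show ?case by simp
next
  case (Suc i)
  have c: "(Suc i, j) \<in> cells d m" using svtD(3)[OF S] Suc.prems by blast
  show ?case
  proof (cases "i = 0")
    case True
    then show ?thesis using svtD(1)[OF S Suc.prems] by simp
  next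
    case False
    then have "(i, j) \<in> cells d m" using c decD[OF m, of i] by auto
    then obtain b where b: "b \<in> S (i, j)" using svtD(3)[OF S] by blast
    then show ?thesis using Suc.IH[OF b] svtD(5)[OF S b Suc.prems] by simp
  qed
qed

text \<open>Recovers a row from its cardinality; the shapes attached to tableaux below are defined
  by counting cells.\<close>

lemma downset_eq_interval:
  assumes "finite A" "(0::nat) \<notin> A" "\<And>j. 1 \<le> j \<Longrightarrow> Suc j \<in> A \<Longrightarrow> j \<in> A"
  shows "A = {1..card A}"
proof (cases "A = {}")
  case False
  have *: "n \<in> A \<Longrightarrow> {1..n} \<subseteq> A" for n
  proof (induction n)
    case (Suc n)
    then show ?case using assms(3)[of n] by (cases "n = 0") (auto simp: le_Suc_eq)
  qed simp
  have "{1..Max A} \<subseteq> A" using * False assms(1) by simp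
  moreover have "A \<subseteq> {1..Max A}"
  proof
    fix x assume "x \<in> A"
    then show "x \<in> {1..Max A}" using assms(1,2) by (cases x) auto
  qed
  ultimately have "A = {1..Max A}" by blast
  then show ?thesis by (metis card_atLeastAtMost diff_Suc_1)
qed simp

section \<open>Removing the largest entry as a bijection\<close>

definition lower_shape :: "nat \<Rightarrow> (nat \<times> nat \<Rightarrow> nat set) \<Rightarrow> nat \<Rightarrow> nat" where
  "lower_shape d S = (\<lambda>i\<in>{1..d}. card {j. S (i, j) - {Suc d} \<noteq> {}})"

text \<open>The cells that receive d + 1. The update \<open>k(Suc d := 0)\<close> declares row d + 1
  of the lower shape empty; an element of \<open>interlacing d m\<close> is \<open>undefined\<close>
  there.\<close>

definition add_entries ::
    "nat \<Rightarrow> (nat \<Rightarrow> nat) \<Rightarrow> (nat \<Rightarrow> nat) \<Rightarrow> nat set \<Rightarrow> (nat \<times> nat) set" where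
  "add_entries d m k E = {(i, j). (i, j) \<in> cells (Suc d) m \<and> (k(Suc d := 0)) i < j} \<union> {(i, k i) | i. i \<in> E}"

definition join_entries ::
    "nat \<Rightarrow> (nat \<Rightarrow> nat) \<Rightarrow> (nat \<Rightarrow> nat) \<Rightarrow> (nat \<times> nat \<Rightarrow> nat set) \<Rightarrow> nat set \<Rightarrow> nat \<times> nat \<Rightarrow> nat set" where
  "join_entries d m k S E c = S c \<union> (if c \<in> add_entries d m k E then {Suc d} else {})"

text \<open>The shapes \<open>k\<close> for which \<open>m / k\<close> is a horizontal strip. The
  extensional function space gives each shape exactly one representative, so a sum over shapes
  counts none twice.\<close>

definition interlacing :: "nat \<Rightarrow> (nat \<Rightarrow> nat) \<Rightarrow> (nat \<Rightarrow> nat) set" where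
  "interlacing d m = (\<Pi>\<^sub>E i\<in>{1..d}. {m (Suc i)..m i})"

text \<open>The set component lists the rows whose last remaining cell also holds d + 1. The strict
  inequality says that the row is not empty and that no cell of \<open>m\<close> lies below that
  cell.\<close>

definition branch_index ::
    "nat \<Rightarrow> (nat \<Rightarrow> nat) \<Rightarrow> ((nat \<Rightarrow> nat) \<times> (nat \<times> nat \<Rightarrow> nat set) \<times> nat set) set" where
  "branch_index d m = (SIGMA k:interlacing d m. svt d k \<times> Pow {i\<in>{1..d}. m (Suc i) < k i})"

text \<open>Rows increase weakly, so the cells of a row that keep an entry other than d + 1 form an
  initial segment; row d + 1 keeps nothing by \<open>row_le_entry\<close>.\<close>

lemma lower_shape_iff:
  assumes S: "S \<in> svt (Suc d) m" and m: "dec (Suc d) m"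
  shows "S (i, j) - {Suc d} \<noteq> {} \<longleftrightarrow> (i, j) \<in> cells d (lower_shape d S)"
proof (cases "1 \<le> i \<and> i \<le> d")
  case True
  let ?A = "{j. S (i, j) - {Suc d} \<noteq> {}}"
  have sub: "?A \<subseteq> {1..m i}" using svt_cell[OF S] by auto
  have "?A = {1..card ?A}"
  proof (rule downset_eq_interval)
    show "finite ?A" using sub finite_subset by blast
    show "0 \<notin> ?A" using sub by fastforce
    fix j assume j: "1 \<le> j" "Suc j \<in> ?A"
    then obtain b where b: "b \<in> S (i, Suc j)" "b \<noteq> Suc d" by blast
    have "(i, j) \<in> cells (Suc d) m" using j sub True by auto
    then obtain a where a: "a \<in> S (i, j)" using svtD(3)[OF S] by blast
    have "a \<le> b" "b \<le> Suc d" using svtD(4)[OF S a b(1)] svtD(2)[OF S b(1)] by auto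
    then show "j \<in> ?A" using a b by fastforce
  qed
  then have "j \<in> ?A \<longleftrightarrow> j \<in> {1..card ?A}" by blast
  then show ?thesis using True by (simp add: lower_shape_def)
next
  case False
  have "S (i, j) - {Suc d} = {}"
  proof (rule ccontr)
    assume "\<not> ?thesis"
    then obtain a where a: "a \<in> S (i, j)" "a \<noteq> Suc d" by blast
    have "(i, j) \<in> cells (Suc d) m" using svtD(3)[OF S] a by blast
    then show False using False row_le_entry[OF S m a(1)] svtD(2)[OF S a(1)] a(2) by auto
  qed
  then show ?thesis using False by auto
qed

text \<open>A cell with a cell of the tableau below it holds an entry less than d + 1, by strictness
  of columns, and survives; hence the lower bound.\<close>

lemma lower_shape_interlacing:
  assumes S: "S \<in> svt (Suc d) m" and m: "dec (Suc d) m"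
  shows "lower_shape d S \<in> interlacing d m"
  unfolding interlacing_def
proof (rule PiE_I)
  fix i assume i: "i \<in> {1..d}"
  let ?k = "lower_shape d S i"
  have "?k \<le> m i"
  proof (cases "?k = 0")
    case False
    then have "(i, ?k) \<in> cells d (lower_shape d S)" using i by auto
    then have "S (i, ?k) \<noteq> {}" using lower_shape_iff[OF S m] by blast
    then show ?thesis using svtD(3)[OF S] by auto
  qed simp
  moreover have "m (Suc i) \<le> ?k"
  proof (cases "m (Suc i) = 0")
    case False
    then have c: "(Suc i, m (Suc i)) \<in> cells (Suc d) m" "(i, m (Suc i)) \<in> cells (Suc d) m"
      using i decD[OF m, of i] by auto
    then obtain a b where ab: "b \<in> S (Suc i, m (Suc i))" "a \<in> S (i, m (Suc i))"
      using svtD(3)[OF S] by blast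
    then have "a < b" "b \<le> Suc d" using svtD(5)[OF S] svtD(2)[OF S] by blast+
    then have "S (i, m (Suc i)) - {Suc d} \<noteq> {}" using ab by fastforce
    then show ?thesis using lower_shape_iff[OF S m] by auto
  qed simp
  ultimately show "?k \<in> {m (Suc i)..m i}" by simp
qed (auto simp: lower_shape_def)

lemma lower_part_svt:
  assumes S: "S \<in> svt (Suc d) m" and m: "dec (Suc d) m"
  shows "(\<lambda>c. S c - {Suc d}) \<in> svt d (lower_shape d S)"
proof -
  have "S c - {Suc d} \<subseteq> {1..d}" for c
    using svtD(1,2)[OF S, of _ c] by (fastforce simp: le_Suc_eq)
  moreover have "S c - {Suc d} \<noteq> {} \<longleftrightarrow> c \<in> cells d (lower_shape d S)" for c
    using lower_shape_iff[OF S m] by (cases c) auto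
  ultimately show ?thesis using svtD(4,5)[OF S] unfolding svt_def by blast
qed

text \<open>Inside the lower shape only a row end can hold d + 1, since any cell further left has an
  entry at most d to its right. Outside the lower shape a cell has nothing else to hold.\<close>

lemma max_entry_iff:
  assumes S: "S \<in> svt (Suc d) m" and m: "dec (Suc d) m"
  shows "Suc d \<in> S (i, j) \<longleftrightarrow> (i, j) \<in> add_entries d m (lower_shape d S) {i \<in> {1..d}. Suc d \<in> S (i, lower_shape d S i)}"
    (is "_ \<longleftrightarrow> _ \<in> add_entries d m ?k ?E")
proof
  assume D: "Suc d \<in> S (i, j)"
  then have c: "(i, j) \<in> cells (Suc d) m" using svtD(3)[OF S] by blast
  show "(i, j) \<in> add_entries d m ?k ?E"
  proof (cases "(?k(Suc d := 0)) i < j")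
    case True
    then show ?thesis using c by (auto simp: add_entries_def)
  next
    case False
    then have i: "1 \<le> i" "i \<le> d" and j: "1 \<le> j" "j \<le> ?k i" using c by (auto split: if_splits)
    have "j = ?k i"
    proof (rule ccontr)
      assume "j \<noteq> ?k i"
      then have "(i, Suc j) \<in> cells d ?k" using i j by auto
      then obtain b where b: "b \<in> S (i, Suc j)" "b \<noteq> Suc d" using lower_shape_iff[OF S m] by blast
      then show False using svtD(4)[OF S D b(1)] svtD(2)[OF S b(1)] by simp
    qed
    then show ?thesis using i D by (auto simp: add_entries_def)
  qed
next
  assume "(i, j) \<in> add_entries d m ?k ?E"
  then consider "(i, j) \<in> cells (Suc d) m" "(?k(Suc d := 0)) i < j" | "i \<in> ?E" "j = ?k i"
    by (auto simp: add_entries_def)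
  then show "Suc d \<in> S (i, j)"
  proof cases
    case 1
    then have "(i, j) \<notin> cells d ?k" by (auto split: if_splits)
    then have "S (i, j) - {Suc d} = {}" using lower_shape_iff[OF S m] by blast
    then show ?thesis using 1 svtD(3)[OF S] by blast
  qed simp
qed

lemma split_in_branch_index:
  assumes S: "S \<in> svt (Suc d) m" and m: "dec (Suc d) m"
  shows "(lower_shape d S, \<lambda>c. S c - {Suc d}, {i \<in> {1..d}. Suc d \<in> S (i, lower_shape d S i)})
    \<in> branch_index d m"
proof -
  let ?k = "lower_shape d S"
  have "m (Suc i) < ?k i" if i: "i \<in> {1..d}" "Suc d \<in> S (i, ?k i)" for i
  proof (rule ccontr)
    assume "\<not> m (Suc i) < ?k i"
    moreover have "(i, ?k i) \<in> cells (Suc d) m" using i svtD(3)[OF S] by blast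
    ultimately have "(Suc i, ?k i) \<in> cells (Suc d) m" using i by auto
    then obtain b where b: "b \<in> S (Suc i, ?k i)" using svtD(3)[OF S] by blast
    show False using svtD(5)[OF S i(2) b] svtD(2)[OF S b] by simp
  qed
  then show ?thesis
    using lower_shape_interlacing[OF S m] lower_part_svt[OF S m] by (auto simp: branch_index_def)
qed

lemma join_split:
  assumes S: "S \<in> svt (Suc d) m" and m: "dec (Suc d) m"
  shows "join_entries d m (lower_shape d S) (\<lambda>c. S c - {Suc d})
    {i \<in> {1..d}. Suc d \<in> S (i, lower_shape d S i)} = S"
proof
  fix c :: "nat \<times> nat"
  obtain i j where c: "c = (i, j)" by (cases c)
  show "join_entries d m (lower_shape d S) (\<lambda>c. S c - {Suc d})
    {i \<in> {1..d}. Suc d \<in> S (i, lower_shape d S i)} c = S c"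
    unfolding join_entries_def c max_entry_iff[OF S m, symmetric] by auto
qed

lemma add_entries_subset:
  assumes "(k, S, E) \<in> branch_index d m"
  shows "add_entries d m k E \<subseteq> cells (Suc d) m"
  using assms by (fastforce simp: branch_index_def add_entries_def interlacing_def PiE_iff)

lemma cells_interlacing_subset:
  assumes "k \<in> interlacing d m"
  shows "cells d k \<subseteq> cells (Suc d) m"
proof clarify
  fix i j assume "(i, j) \<in> cells d k"
  then have "1 \<le> i" "i \<le> d" "1 \<le> j" "j \<le> k i" by auto
  moreover from this have "k i \<le> m i" using assms by (auto simp: interlacing_def PiE_iff)
  ultimately show "(i, j) \<in> cells (Suc d) m" by simp
qed

lemma join_svt:
  assumes b: "(k, S, E) \<in> branch_index d m" and m: "dec (Suc d) m"
  shows "join_entries d m k S E \<in> svt (Suc d) m"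
proof -
  have k: "k \<in> interlacing d m" and S: "S \<in> svt d k" and E: "E \<subseteq> {i\<in>{1..d}. m (Suc i) < k i}"
    using b by (auto simp: branch_index_def)
  have k1: "m (Suc i) \<le> k i" "k i \<le> m i" if "1 \<le> i" "i \<le> d" for i
    using k that by (auto simp: interlacing_def PiE_iff)
  let ?T = "join_entries d m k S E"
  have mem: "a \<in> ?T c \<longleftrightarrow> a \<in> S c \<or> a = Suc d \<and> c \<in> add_entries d m k E" for a c
    by (auto simp: join_entries_def)
  have sub: "?T c \<subseteq> {1..Suc d}" for c
    using svtD(1,2)[OF S, of _ c] by (auto simp: mem le_Suc_eq)
  have ne: "?T c \<noteq> {} \<longleftrightarrow> c \<in> cells (Suc d) m" for c
  proof -
    obtain i j where c: "c = (i, j)" by (cases c)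
    have "c \<in> cells (Suc d) m \<Longrightarrow> c \<in> cells d k \<or> c \<in> add_entries d m k E"
      by (auto simp: c add_entries_def)
    moreover have "?T c \<noteq> {} \<longleftrightarrow> c \<in> cells d k \<or> c \<in> add_entries d m k E"
      using svtD(3)[OF S, of c] by (auto simp: join_entries_def)
    ultimately show ?thesis using add_entries_subset[OF b] cells_interlacing_subset[OF k] by blast
  qed
  have row: "a \<le> b" if ab: "a \<in> ?T (i, j)" "b \<in> ?T (i, Suc j)" for i j a b
  proof -
    consider "b = Suc d" | "b \<in> S (i, Suc j)" "a \<in> S (i, j)"
      | "b \<in> S (i, Suc j)" "(i, j) \<in> add_entries d m k E"
      using ab unfolding mem by blast
    then show ?thesis
    proof cases
      case 1 then show ?thesis using sub[of "(i, j)"] that by auto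
    next
      case 2 then show ?thesis using svtD(4)[OF S] by blast
    next
      case 3
      have "(i, Suc j) \<in> cells d k" using 3 svtD(3)[OF S] by blast
      then show ?thesis using 3(2) by (auto simp: add_entries_def)
    qed
  qed
  have col: "a < b" if ab: "a \<in> ?T (i, j)" "b \<in> ?T (Suc i, j)" for i j a b
  proof -
    have "(i, j) \<in> cells (Suc d) m" "(Suc i, j) \<in> cells (Suc d) m" using that ne by blast+
    then have *: "j \<le> m (Suc i)" "1 \<le> i" "i \<le> d" "1 \<le> j" by auto
    have "(i, j) \<notin> add_entries d m k E"
      using * k1[of i] E by (auto simp: add_entries_def)
    then have a: "a \<in> S (i, j)" using ab unfolding mem by blast
    consider "b = Suc d" | "b \<in> S (Suc i, j)" using ab unfolding mem by blast
    then show ?thesis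
    proof cases
      case 1
      then show ?thesis using svtD(2)[OF S a] by simp
    next
      case 2
      then show ?thesis using svtD(5)[OF S a] by blast
    qed
  qed
  show ?thesis using sub ne row col unfolding svt_def by blast
qed

lemma split_join:
  assumes b: "(k, S, E) \<in> branch_index d m"
  shows "(\<lambda>c. join_entries d m k S E c - {Suc d}) = S"
    and "lower_shape d (join_entries d m k S E) = k"
    and "{i \<in> {1..d}. Suc d \<in> join_entries d m k S E (i, k i)} = E"
proof -
  have k: "k \<in> interlacing d m" and S: "S \<in> svt d k" and E: "E \<subseteq> {i\<in>{1..d}. m (Suc i) < k i}"
    using b by (auto simp: branch_index_def)
  have D: "Suc d \<notin> S c" for c using svtD(2)[OF S, of "Suc d" c] by auto
  show *: "(\<lambda>c. join_entries d m k S E c - {Suc d}) = S"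
    using D by (auto simp: join_entries_def fun_eq_iff)
  show "lower_shape d (join_entries d m k S E) = k"
  proof
    fix i
    have "{j. join_entries d m k S E (i, j) - {Suc d} \<noteq> {}} = {j. (i, j) \<in> cells d k}"
      using fun_cong[OF *] svtD(3)[OF S] by auto
    also have "\<dots> = {1..k i}" if "i \<in> {1..d}" using that by auto
    finally have "card {j. join_entries d m k S E (i, j) - {Suc d} \<noteq> {}} = k i" if "i \<in> {1..d}"
      using that by simp
    moreover have "k i = undefined" if "i \<notin> {1..d}" using k that
      by (auto simp: interlacing_def PiE_iff extensional_def)
    ultimately show "lower_shape d (join_entries d m k S E) i = k i"
      by (auto simp: lower_shape_def)
  qed
  show "{i \<in> {1..d}. Suc d \<in> join_entries d m k S E (i, k i)} = E"
    using E D by (auto simp: join_entries_def add_entries_def)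
qed

text \<open>The weight splits along the entries: those of \<open>S\<close>, the copies of d + 1
  beyond the lower shape, and the copies that share a row end. Row d + 1 keeps no cells, so its
  strip starts at 0.\<close>

lemma join_weight:
  assumes b: "(k, S, E) \<in> branch_index d m"
  shows "(\<Prod>c\<in>cells (Suc d) m. \<Prod>r\<in>join_entries d m k S E c. cell_weight X A r c)
    = (\<Prod>c\<in>cells d k. \<Prod>r\<in>S c. cell_weight X A r c)
      * ((\<Prod>i=1..d. strip_weight X A (Suc d) i (m i) (k i))
          * strip_weight X A (Suc d) (Suc d) (m (Suc d)) 0)
      * (\<Prod>i\<in>E. X (Suc d) * A (int (Suc d) + int (k i) - int i) - 1)"
proof -
  have k: "k \<in> interlacing d m" and S: "S \<in> svt d k" and E: "E \<subseteq> {i\<in>{1..d}. m (Suc i) < k i}"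
    using b by (auto simp: branch_index_def)
  have k1: "k i \<le> m i" if "1 \<le> i" "i \<le> d" for i
    using k that by (auto simp: interlacing_def PiE_iff)
  have D: "Suc d \<notin> S c" for c using svtD(2)[OF S, of "Suc d" c] by auto
  have fS: "finite (S c)" for c using svtD(1,2)[OF S, of _ c]
    by (intro finite_subset[of "S c" "{1..d}"]) auto
  let ?w = "cell_weight X A"
  let ?F = "add_entries d m k E"
  have sub: "?F \<subseteq> cells (Suc d) m" by (rule add_entries_subset[OF b])
  have "(\<Prod>r\<in>join_entries d m k S E c. ?w r c) = (\<Prod>r\<in>S c. ?w r c) * (if c \<in> ?F then ?w (Suc d) c else 1)" for c
    using D fS by (simp add: join_entries_def mult.commute)
  then have "(\<Prod>c\<in>cells (Suc d) m. \<Prod>r\<in>join_entries d m k S E c. ?w r c)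
    = (\<Prod>c\<in>cells (Suc d) m. \<Prod>r\<in>S c. ?w r c) * (\<Prod>c\<in>cells (Suc d) m. if c \<in> ?F then ?w (Suc d) c else 1)"
    by (simp add: prod.distrib)
  also have "(\<Prod>c\<in>cells (Suc d) m. \<Prod>r\<in>S c. ?w r c) = (\<Prod>c\<in>cells d k. \<Prod>r\<in>S c. ?w r c)"
  proof (rule prod.mono_neutral_right)
    show "\<forall>c\<in>cells (Suc d) m - cells d k. (\<Prod>r\<in>S c. ?w r c) = 1"
      using svtD(3)[OF S] by (metis DiffD2 prod.empty)
  qed (simp_all add: cells_interlacing_subset[OF k])
  also have "(\<Prod>c\<in>cells (Suc d) m. if c \<in> ?F then ?w (Suc d) c else 1) = (\<Prod>c\<in>?F. ?w (Suc d) c)"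
    using sub by (subst prod.inter_restrict[symmetric]) (auto simp: Int_absorb1)
  also have "\<dots> = (\<Prod>c\<in>(SIGMA i:{1..Suc d}. {(k(Suc d := 0)) i<..m i}). ?w (Suc d) c)
      * (\<Prod>c\<in>(\<lambda>i. (i, k i)) ` E. ?w (Suc d) c)"
  proof -
    have "?F = (SIGMA i:{1..Suc d}. {(k(Suc d := 0)) i<..m i}) \<union> (\<lambda>i. (i, k i)) ` E"
      by (auto simp: add_entries_def)
    moreover have "(SIGMA i:{1..Suc d}. {(k(Suc d := 0)) i<..m i}) \<inter> (\<lambda>i. (i, k i)) ` E = {}"
      using E by auto
    moreover have "finite E" using E finite_subset by fastforce
    ultimately show ?thesis by (simp add: prod.union_disjoint del: fun_upd_apply)
  qed
  also have "(\<Prod>c\<in>(\<lambda>i. (i, k i)) ` E. ?w (Suc d) c)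
      = (\<Prod>i\<in>E. X (Suc d) * A (int (Suc d) + int (k i) - int i) - 1)"
    by (subst prod.reindex) (auto simp: inj_on_def cell_weight_def)
  also have "(\<Prod>c\<in>(SIGMA i:{1..Suc d}. {(k(Suc d := 0)) i<..m i}). ?w (Suc d) c)
      = (\<Prod>i\<in>{1..Suc d}. \<Prod>j\<in>{(k(Suc d := 0)) i<..m i}. ?w (Suc d) (i, j))"
    by (subst prod.Sigma) auto
  also have "\<dots> = (\<Prod>i=1..d. strip_weight X A (Suc d) i (m i) (k i))
          * strip_weight X A (Suc d) (Suc d) (m (Suc d)) 0"
    using k1 by (auto simp: strip_weight_def cell_weight_def intro!: arg_cong2[where f="(*)"] prod.cong)
  finally show ?thesis by (simp only: mult.assoc)
qed

lemma groth_branch: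
  assumes m: "dec (Suc d) m"
  shows "groth X A (Suc d) m = (\<Sum>k\<in>interlacing d m. groth X A d k
     * (\<Prod>i=1..d. strip_weight X A (Suc d) i (m i) (k i) * end_weight X A (Suc d) i (k i) (m (Suc i)))
     * strip_weight X A (Suc d) (Suc d) (m (Suc d)) 0)"
proof -
  let ?w = "\<lambda>k i. X (Suc d) * A (int (Suc d) + int (k i) - int i) - 1"
  let ?I = "\<lambda>k. {i\<in>{1..d}. m (Suc i) < k i}"
  let ?P = "\<lambda>k. (\<Prod>i=1..d. strip_weight X A (Suc d) i (m i) (k i))
          * strip_weight X A (Suc d) (Suc d) (m (Suc d)) 0"
  let ?W = "\<lambda>k S. \<Prod>c\<in>cells d k. \<Prod>r\<in>S c. cell_weight X A r c"
  have fin: "finite (interlacing d m)" by (auto simp: interlacing_def intro!: finite_PiE)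
  have "groth X A (Suc d) m = (\<Sum>(k, S, E)\<in>branch_index d m. ?W k S * ?P k * (\<Prod>i\<in>E. ?w k i))"
    unfolding groth_def
  proof (rule sum.reindex_bij_witness[where
        i = "\<lambda>(k, S, E). join_entries d m k S E" and
        j = "\<lambda>S. (lower_shape d S, \<lambda>c. S c - {Suc d}, {i \<in> {1..d}. Suc d \<in> S (i, lower_shape d S i)})"])
    fix S assume S: "S \<in> svt (Suc d) m"
    show "(case (lower_shape d S, \<lambda>c. S c - {Suc d}, {i \<in> {1..d}. Suc d \<in> S (i, lower_shape d S i)}) of
            (k, S, E) \<Rightarrow> join_entries d m k S E) = S"
      using join_split[OF S m] by simp
    show "(lower_shape d S, \<lambda>c. S c - {Suc d}, {i \<in> {1..d}. Suc d \<in> S (i, lower_shape d S i)})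
        \<in> branch_index d m"
      by (rule split_in_branch_index[OF S m])
    from join_weight[OF this, of X A]
    show "(case (lower_shape d S, \<lambda>c. S c - {Suc d}, {i \<in> {1..d}. Suc d \<in> S (i, lower_shape d S i)}) of
            (k, S, E) \<Rightarrow> ?W k S * ?P k * (\<Prod>i\<in>E. ?w k i))
       = (\<Prod>c\<in>cells (Suc d) m. \<Prod>r\<in>S c. cell_weight X A r c)"
      unfolding join_split[OF S m] by (simp only: case_prod_conv)
  next
    fix b assume "b \<in> branch_index d m"
    moreover obtain k S E where b: "b = (k, S, E)" by (cases b)
    ultimately have b': "(k, S, E) \<in> branch_index d m" by simp
    show "(case b of (k, S, E) \<Rightarrow> join_entries d m k S E) \<in> svt (Suc d) m"
      using join_svt[OF b' m] b by simp
    show "(lower_shape d (case b of (k, S, E) \<Rightarrow> join_entries d m k S E),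
          \<lambda>c. (case b of (k, S, E) \<Rightarrow> join_entries d m k S E) c - {Suc d},
          {i \<in> {1..d}. Suc d \<in> (case b of (k, S, E) \<Rightarrow> join_entries d m k S E)
            (i, lower_shape d (case b of (k, S, E) \<Rightarrow> join_entries d m k S E) i)}) = b"
      using split_join[OF b'] b by simp
  qed
  also have "\<dots> = (\<Sum>k\<in>interlacing d m. \<Sum>S\<in>svt d k. \<Sum>E\<in>Pow (?I k). ?W k S * ?P k * (\<Prod>i\<in>E. ?w k i))"
    unfolding branch_index_def using fin
    by (subst sum.Sigma[symmetric]) (auto simp: sum.cartesian_product)
  also have "\<dots> = (\<Sum>k\<in>interlacing d m. groth X A d k * ?P k * (\<Sum>E\<in>Pow (?I k). \<Prod>i\<in>E. ?w k i))"
    by (rule sum.cong[OF refl], subst groth_def, subst sum_distrib_right, subst sum_product, rule refl)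
  also have "\<dots> = (\<Sum>k\<in>interlacing d m. groth X A d k
     * (\<Prod>i=1..d. strip_weight X A (Suc d) i (m i) (k i) * end_weight X A (Suc d) i (k i) (m (Suc i)))
     * strip_weight X A (Suc d) (Suc d) (m (Suc d)) 0)"
  proof (rule sum.cong[OF refl])
    fix k assume k: "k \<in> interlacing d m"
    \<comment> \<open>Expanding a product of terms \<open>w + 1\<close> gives the sum over subsets.
      In the remaining rows interlacing forces \<open>k i = m (Suc i)\<close>, where
      \<open>end_weight\<close> is 1.\<close>
    have "(\<Sum>E\<in>Pow (?I k). \<Prod>i\<in>E. ?w k i) = (\<Prod>i\<in>?I k. ?w k i + 1)"
      by (subst prod_add) auto
    also have "\<dots> = (\<Prod>i=1..d. end_weight X A (Suc d) i (k i) (m (Suc i)))"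
      using k by (intro prod.mono_neutral_cong_left)
        (auto simp: end_weight_def interlacing_def PiE_iff not_less dest!: bspec)
    finally show "groth X A d k * ?P k * (\<Sum>E\<in>Pow (?I k). \<Prod>i\<in>E. ?w k i) = groth X A d k
     * (\<Prod>i=1..d. strip_weight X A (Suc d) i (m i) (k i) * end_weight X A (Suc d) i (k i) (m (Suc i)))
     * strip_weight X A (Suc d) (Suc d) (m (Suc d)) 0"
      by (simp add: prod.distrib ac_simps)
  qed
  finally show ?thesis .
qed

subsection \<open>The Pieri rule\<close>

text \<open>Shapes with at most one added cell in each row and column, including \<open>m\<close>
  itself. Bounding by the old part \<open>m (i - 1)\<close> is what forbids two added cells in a
  column, and it makes the set a product over the rows.\<close>

definition rook_extensions :: "nat \<Rightarrow> (nat \<Rightarrow> nat) \<Rightarrow> (nat \<Rightarrow> nat) set" where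
  "rook_extensions d m =
     (\<Pi>\<^sub>E i\<in>{1..d}. {n. m i \<le> n \<and> n \<le> Suc (m i) \<and> (1 < i \<longrightarrow> n \<le> m (i - 1))})"

text \<open>Terms outside \<open>interlacing d m\<close> vanish through the guards in
  \<open>strip_weight\<close> and \<open>end_weight\<close>. The enlarged index set depends on the
  shape only through the bound \<open>N\<close>, which permits interchanging the sums over shapes in
  the Pieri rule.\<close>

lemma groth_branch_bounded:
  assumes m: "dec (Suc d) m" and N: "\<And>i. 1 \<le> i \<Longrightarrow> i \<le> d \<Longrightarrow> m i \<le> N"
  shows "groth X A (Suc d) m = (\<Sum>k\<in>{1..d} \<rightarrow>\<^sub>E {..N}. groth X A d k
     * (\<Prod>i=1..d. strip_weight X A (Suc d) i (m i) (k i) * end_weight X A (Suc d) i (k i) (m (Suc i)))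
     * strip_weight X A (Suc d) (Suc d) (m (Suc d)) 0)"
  unfolding groth_branch[OF m]
proof (rule sum.mono_neutral_left)
  show "finite ({1..d} \<rightarrow>\<^sub>E {..N})" by (auto intro: finite_PiE)
  show "interlacing d m \<subseteq> {1..d} \<rightarrow>\<^sub>E {..N}"
    unfolding interlacing_def using N by (intro PiE_mono) force
  show "\<forall>k\<in>({1..d} \<rightarrow>\<^sub>E {..N}) - interlacing d m. groth X A d k
     * (\<Prod>i=1..d. strip_weight X A (Suc d) i (m i) (k i) * end_weight X A (Suc d) i (k i) (m (Suc i)))
     * strip_weight X A (Suc d) (Suc d) (m (Suc d)) 0 = 0"
  proof
    fix k assume "k \<in> ({1..d} \<rightarrow>\<^sub>E {..N}) - interlacing d m"
    then obtain i where i: "i \<in> {1..d}" "\<not> (m (Suc i) \<le> k i \<and> k i \<le> m i)"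
      by (auto simp: interlacing_def PiE_iff)
    then have "strip_weight X A (Suc d) i (m i) (k i) * end_weight X A (Suc d) i (k i) (m (Suc i)) = 0"
      by (auto simp: strip_weight_def end_weight_def)
    then have "(\<Prod>i=1..d. strip_weight X A (Suc d) i (m i) (k i) * end_weight X A (Suc d) i (k i) (m (Suc i))) = 0"
      using i by (intro prod_zero) auto
    then show "groth X A d k
     * (\<Prod>i=1..d. strip_weight X A (Suc d) i (m i) (k i) * end_weight X A (Suc d) i (k i) (m (Suc i)))
     * strip_weight X A (Suc d) (Suc d) (m (Suc d)) 0 = 0" by simp
  qed
qed

text \<open>\<open>strip_weight\<close> without its guard. It is a common factor of all terms of a
  row sum, also where the guard fails for one of them because \<open>k = Suc n\<close>.\<close>

definition strip_prod ::
    "(nat \<Rightarrow> 'a::field) \<Rightarrow> (int \<Rightarrow> 'a) \<Rightarrow> nat \<Rightarrow> nat \<Rightarrow> nat \<Rightarrow> nat \<Rightarrow> 'a" where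
  "strip_prod X A D i n k = (\<Prod>j\<in>{k<..n}. X D * A (int D + int j - int i) - 1)"

lemma strip_weight_Suc:
  assumes "s \<le> Suc n"
  shows "strip_weight X A D i (Suc n) s
    = strip_prod X A D i n s * (if s \<le> n then X D * A (int D + int n + 1 - int i) - 1 else 1)"
proof (cases "s \<le> n")
  case True
  then have "{s<..Suc n} = insert (Suc n) {s<..n}" by auto
  then show ?thesis using True by (simp add: strip_weight_def strip_prod_def algebra_simps)
next
  case False
  then have "s = Suc n" using assms by simp
  then show ?thesis by (simp add: strip_weight_def strip_prod_def)
qed

lemma strip_weight_same:
  "strip_weight X A D i n s = strip_prod X A D i n s * (if s \<le> n then 1 else 0)"
  by (simp add: strip_weight_def strip_prod_def)

lemma strip_weight_pred:
  assumes "0 < r" "r \<le> Suc m"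
  shows "strip_weight X A D i m (r - 1)
    = strip_prod X A D i m r * (if r \<le> m then X D * A (int D + int r - int i) - 1 else 1)"
proof (cases "r \<le> m")
  case True
  then have "{r - 1<..m} = insert r {r<..m}" using assms by auto
  then show ?thesis using True by (simp add: strip_weight_def strip_prod_def algebra_simps)
next
  case False
  then show ?thesis using assms by (simp add: strip_weight_def strip_prod_def)
qed

text \<open>Row-wise coefficients of \<open>G\<^sub>\<rho>\<close> on the two sides of the Pieri rule, where \<open>m, n\<close> and \<open>r, s\<close> are the parts
  \<open>i, i + 1\<close> of \<open>\<mu>\<close> and \<open>\<rho>\<close>: \<open>outer_sum\<close> extends \<open>\<mu>\<close> before branching (row \<open>i + 1\<close>), \<open>inner_sum\<close> branches
  before extending (row \<open>i\<close>). They differ by the factors \<open>excess\<close>, which telescope over the rows.\<close>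

definition outer_sum ::
    "(nat \<Rightarrow> 'a::field) \<Rightarrow> (int \<Rightarrow> 'a) \<Rightarrow> nat \<Rightarrow> nat \<Rightarrow> nat \<Rightarrow> nat \<Rightarrow> nat \<Rightarrow> nat \<Rightarrow> 'a" where
  "outer_sum X A D i m n r s = (\<Sum>v\<in>{v. n \<le> v \<and> v \<le> Suc n \<and> v \<le> m}.
      end_weight X A D i r v * strip_weight X A D (Suc i) v s)"

definition inner_sum ::
    "(nat \<Rightarrow> 'a::field) \<Rightarrow> (int \<Rightarrow> 'a) \<Rightarrow> nat \<Rightarrow> nat \<Rightarrow> nat \<Rightarrow> nat \<Rightarrow> nat \<Rightarrow> nat \<Rightarrow> 'a" where
  "inner_sum X A D i m n r s = (\<Sum>k\<in>{n..m}. if k \<le> r \<and> r \<le> Suc k \<and> s \<le> k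
      then strip_weight X A D i m k * end_weight X A D i k n / A (int D + int k - int i) else 0)"

definition excess :: "(nat \<Rightarrow> 'a::field) \<Rightarrow> (int \<Rightarrow> 'a) \<Rightarrow> nat \<Rightarrow> nat \<Rightarrow> nat \<Rightarrow> nat \<Rightarrow> 'a" where
  "excess X A D i m r = (if r = Suc m then X D * A (int D + int r - int i) else 1)"

lemma outer_sum_closed_form:
  assumes "n \<le> m" "r \<le> Suc m" "s \<le> Suc n"
  shows "outer_sum X A D i m n r s = strip_prod X A D (Suc i) n s *
    (let x = X D; a = (\<lambda>k. A (int D + int k - int i)) in
     if r < n then 0
     else if r = n then (if s \<le> n then 1 else 0)
     else if r = Suc n then
       (if m = n then (if s \<le> n then x * a r else 0)
        else if s \<le> n then x * a r + x * a n - 1 else 1)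
     else x * a r * (if s \<le> n then x * a n else 1))"
proof (cases "m = n")
  case True
  then have "{v. n \<le> v \<and> v \<le> Suc n \<and> v \<le> m} = {n}" by auto
  then show ?thesis using True assms
    by (auto simp: outer_sum_def strip_weight_same end_weight_def Let_def)
next
  case False
  then have "{v. n \<le> v \<and> v \<le> Suc n \<and> v \<le> m} = {n, Suc n}" using assms by auto
  then have "outer_sum X A D i m n r s = end_weight X A D i r n * strip_weight X A D (Suc i) n s
      + end_weight X A D i r (Suc n) * strip_weight X A D (Suc i) (Suc n) s"
    by (simp add: outer_sum_def)
  also have "\<dots> = strip_prod X A D (Suc i) n s * (end_weight X A D i r n * (if s \<le> n then 1 else 0)
      + end_weight X A D i r (Suc n) * (if s \<le> n then X D * A (int D + int n - int i) - 1 else 1))"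
  proof -
    \<comment> \<open>Column n + 1 of row i + 1 and column n of row i have the same content, so the
      new strip factor in row i + 1 involves the same \<open>A\<close> as the end of row i.\<close>
    have "int D + int n + 1 - int (Suc i) = int D + int n - int i" by simp
    then show ?thesis
      unfolding strip_weight_Suc[OF assms(3)] strip_weight_same[of X A D "Suc i" n]
      by (simp only: distrib_left mult.left_commute)
  qed
  finally have *: "outer_sum X A D i m n r s = \<dots>" .
  consider "r < n" | "r = n" | "r = Suc n" | "Suc n < r" by linarith
  then show ?thesis
    unfolding * Let_def using False by cases (auto simp: end_weight_def right_diff_distrib)
qed

text \<open>Only \<open>k = r\<close> and \<open>k = r - 1\<close> contribute. The denominator
  cancels against \<open>end_weight\<close> unless \<open>k = n\<close>, where
  \<open>end_weight\<close> is 1 and the inverse survives.\<close>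

lemma inner_sum_closed_form:
  assumes A: "\<And>k. A k \<noteq> 0" and "n \<le> m" "r \<le> Suc m"
  shows "inner_sum X A D i m n r s = strip_prod X A D i m r *
    (let x = X D; a = (\<lambda>k. A (int D + int k - int i)) in
     (if s \<le> r \<and> n \<le> r \<and> r \<le> m then (if r = n then 1 / a r else x) else 0)
     + (if Suc n \<le> r \<and> s < r then (if r \<le> m then x * a r - 1 else 1) * (if r = Suc n then 1 / a n else x)
        else 0))"
proof -
  let ?t = "\<lambda>k. if k \<le> r \<and> r \<le> Suc k \<and> s \<le> k
      then strip_weight X A D i m k * end_weight X A D i k n / A (int D + int k - int i) else 0"
  let ?u = "\<lambda>k. if n \<le> k \<and> k \<le> m then ?t k else 0"
  have "inner_sum X A D i m n r s = sum ?t ({n..m} \<inter> {r - 1, r})"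
    unfolding inner_sum_def by (rule sum.mono_neutral_right) auto
  also have "\<dots> = sum ?u {r - 1, r}"
    by (rule sum.mono_neutral_cong_left) auto
  \<comment> \<open>At \<open>r = 0\<close> the two indices coincide because subtraction is
    truncated, so the second term has to be dropped.\<close>
  also have "\<dots> = ?u r + (if 0 < r then ?u (r - 1) else 0)"
    by (cases r) auto
  also have "?u r = strip_prod X A D i m r * (if s \<le> r \<and> n \<le> r \<and> r \<le> m then
      (if r = n then 1 / A (int D + int r - int i) else X D) else 0)"
    using A by (simp add: strip_weight_same end_weight_def)
  also have "(if 0 < r then ?u (r - 1) else 0) = strip_prod X A D i m r *
     (if Suc n \<le> r \<and> s < r then (if r \<le> m then X D * A (int D + int r - int i) - 1 else 1)
       * (if r = Suc n then 1 / A (int D + int n - int i) else X D)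
        else 0)"
  proof (cases "Suc n \<le> r \<and> s < r")
    case True
    then have "?u (r - 1) = strip_weight X A D i m (r - 1) * (end_weight X A D i (r - 1) n / A (int D + int (r - 1) - int i))"
      using assms by auto
    also have "end_weight X A D i (r - 1) n / A (int D + int (r - 1) - int i)
      = (if r = Suc n then 1 / A (int D + int n - int i) else X D)"
      using True A by (auto simp: end_weight_def)
    finally have "?u (r - 1) = strip_weight X A D i m (r - 1)
      * (if r = Suc n then 1 / A (int D + int n - int i) else X D)" .
    moreover have "(if 0 < r then ?u (r - 1) else 0) = ?u (r - 1)" using True by simp
    moreover have "strip_weight X A D i m (r - 1)
      = strip_prod X A D i m r * (if r \<le> m then X D * A (int D + int r - int i) - 1 else 1)"
      using True assms by (intro strip_weight_pred) auto
    ultimately show ?thesis by (simp only: True if_True simp_thms mult.assoc)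
  next
    case False
    then show ?thesis by auto
  qed
  finally show ?thesis by (simp add: Let_def distrib_left)
qed

text \<open>The common cofactor \<open>H\<close> stands in for a quotient by
  \<open>strip_prod\<close>, which may be zero, as happens at the dual point. The factor
  \<open>A\<close> is that of row i + 1 in the Pieri product.\<close>

lemma outer_inner_exchange:
  fixes X :: "nat \<Rightarrow> 'a::field"
  assumes A: "\<And>k. A k \<noteq> 0" and le: "n \<le> m" "r \<le> Suc m" "s \<le> Suc n"
  obtains H where "inner_sum X A D i m n r s = strip_prod X A D i m r * H"
    and "outer_sum X A D i m n r s * excess X A D (Suc i) n s
      = strip_prod X A D (Suc i) n s * H * A (int D + int n - int i) * excess X A D i m r"
proof -
  define a where "a k = A (int D + int k - int i)" for k :: nat
  have a: "a k \<noteq> 0" for k using A by (simp add: a_def)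
  have e: "excess X A D (Suc i) n s = (if s = Suc n then X D * a n else 1)"
    by (simp add: excess_def a_def add_diff_eq)
  define P where "P = strip_prod X A D i m r"
  define Q where "Q = strip_prod X A D (Suc i) n s"
  define x where "x = X D"
  consider "r < n" | "r = n" "r \<le> m" | "r = Suc n" "m = n" | "r = Suc n" "n < m"
    | "Suc n < r" "r \<le> m" | "Suc n < r" "r = Suc m"
    using le by linarith
  then have "Q * (if r < n then 0
     else if r = n then (if s \<le> n then 1 else 0)
     else if r = Suc n then
       (if m = n then (if s \<le> n then x * a r else 0)
        else if s \<le> n then x * a r + x * a n - 1 else 1)
     else x * a r * (if s \<le> n then x * a n else 1)) * (if s = Suc n then x * a n else 1)
   = Q * ((if s \<le> r \<and> n \<le> r \<and> r \<le> m then (if r = n then 1 / a r else x) else 0)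
     + (if Suc n \<le> r \<and> s < r then (if r \<le> m then x * a r - 1 else 1) * (if r = Suc n then 1 / a n else x)
        else 0)) * a n * (if r = Suc m then x * a r else 1)"
  proof cases
    case 1 then show ?thesis by simp
  next
    case 2 then show ?thesis using le a by (cases "s \<le> n") auto
  next
    case 3 then show ?thesis using le a by (cases "s \<le> n") auto
  next
    \<comment> \<open>Two shapes contribute on each side. For \<open>s \<le> n\<close> the value
      \<open>x * a r + x * a n - 1\<close> arises as \<open>x * a r + (x * a n - 1)\<close> from
      extending and as \<open>x * a n + (x * a r - 1)\<close> from branching.\<close>
    case 4 then show ?thesis using le a by (cases "s \<le> n") (auto simp: field_simps le_Suc_eq)
  next
    case 5 then show ?thesis using le a by (cases "s \<le> n") (auto simp: algebra_simps le_Suc_eq)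
  next
    case 6 then show ?thesis using le a by (cases "s \<le> n") (auto simp: algebra_simps le_Suc_eq)
  qed
  then show ?thesis
    unfolding a_def Q_def x_def e[unfolded a_def]
    by (intro that[OF inner_sum_closed_form[OF A le(1,2), unfolded Let_def]])
      (simp only: outer_sum_closed_form[OF le] e excess_def[of X A D i m r] Let_def a_def)
qed

text \<open>Telescoping over the rows: \<open>outer_inner_exchange\<close> trades the
  \<open>excess\<close> of one row for that of the next, completes the pending
  \<open>strip_prod\<close> to an \<open>inner_sum\<close>, and leaves the \<open>strip_prod\<close>
  of the next row pending.\<close>

lemma outer_inner_product:
  fixes X :: "nat \<Rightarrow> 'a::field"
  assumes A: "\<And>k. A k \<noteq> 0" and m: "dec D m"
    and r: "\<And>i. 1 \<le> i \<Longrightarrow> i \<le> D \<Longrightarrow> r i \<le> Suc (m i)"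
  shows "Suc j \<le> D \<Longrightarrow> (\<Sum>v\<in>{m 1, Suc (m 1)}. strip_weight X A D 1 v (r 1))
      * (\<Prod>i=1..j. outer_sum X A D i (m i) (m (Suc i)) (r i) (r (Suc i)))
      * excess X A D (Suc j) (m (Suc j)) (r (Suc j))
    = X D * (\<Prod>i=1..Suc j. A (int (m i) + int D - int i + 1))
      * (\<Prod>i=1..j. inner_sum X A D i (m i) (m (Suc i)) (r i) (r (Suc i)))
      * strip_prod X A D (Suc j) (m (Suc j)) (r (Suc j))"
proof (induction j)
  case 0
  then have "r 1 \<le> Suc (m 1)" using r by simp
  have *: "int D + int (m 1) + 1 - int 1 = int (m 1) + int D - int 1 + 1"
    "int D + int (Suc (m 1)) - int 1 = int (m 1) + int D - int 1 + 1" by simp_all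
  \<comment> \<open>Row 1 has no bound from above. For \<open>r 1 \<le> m 1\<close> the two choices
    add up to \<open>1 + (X A - 1) = X A\<close>; for \<open>r 1 = Suc (m 1)\<close> only the longer
    row contributes, and \<open>excess\<close> supplies \<open>X A\<close>.\<close>
  have "(\<Sum>v\<in>{m 1, Suc (m 1)}. strip_weight X A D 1 v (r 1))
    = strip_weight X A D 1 (m 1) (r 1) + strip_weight X A D 1 (Suc (m 1)) (r 1)" by simp
  also have "\<dots> = strip_prod X A D 1 (m 1) (r 1)
     * (if r 1 \<le> m 1 then X D * A (int (m 1) + int D - int 1 + 1) else 1)"
    unfolding strip_weight_Suc[OF \<open>r 1 \<le> Suc (m 1)\<close>] strip_weight_same[of X A D 1 "m 1"] *
    by (auto simp: algebra_simps)
  finally have f: "(\<Sum>v\<in>{m 1, Suc (m 1)}. strip_weight X A D 1 v (r 1)) = \<dots>" .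
  show ?case
  proof (cases "r 1 \<le> m 1")
    case True
    then show ?thesis unfolding f by (simp add: excess_def)
  next
    case False
    then have e: "r 1 = Suc (m 1)" using \<open>r 1 \<le> Suc (m 1)\<close> by simp
    have x: "excess X A D (Suc 0) (m (Suc 0)) (r (Suc 0)) = X D * A (int (m 1) + int D - int 1 + 1)"
      unfolding excess_def using e *(2) by (simp add: add.commute)
    show ?thesis unfolding f x using False by simp
  qed
next
  case (Suc j)
  have mm: "m (Suc (Suc j)) \<le> m (Suc j)" using Suc.prems by (intro decD[OF m]) auto
  have r1: "r (Suc j) \<le> Suc (m (Suc j))" and r2: "r (Suc (Suc j)) \<le> Suc (m (Suc (Suc j)))"
    using Suc.prems r by auto
  obtain H where H: "inner_sum X A D (Suc j) (m (Suc j)) (m (Suc (Suc j))) (r (Suc j)) (r (Suc (Suc j)))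
      = strip_prod X A D (Suc j) (m (Suc j)) (r (Suc j)) * H"
    "outer_sum X A D (Suc j) (m (Suc j)) (m (Suc (Suc j))) (r (Suc j)) (r (Suc (Suc j)))
        * excess X A D (Suc (Suc j)) (m (Suc (Suc j))) (r (Suc (Suc j)))
      = strip_prod X A D (Suc (Suc j)) (m (Suc (Suc j))) (r (Suc (Suc j))) * H
        * A (int D + int (m (Suc (Suc j))) - int (Suc j)) * excess X A D (Suc j) (m (Suc j)) (r (Suc j))"
    by (rule outer_inner_exchange[where A = A and X = X and D = D and i = "Suc j", OF A mm r1 r2])
  define e where "e = excess X A D (Suc j) (m (Suc j)) (r (Suc j))"
  define e' where "e' = excess X A D (Suc (Suc j)) (m (Suc (Suc j))) (r (Suc (Suc j)))"
  define S where "S = (\<Sum>v\<in>{m 1, Suc (m 1)}. strip_weight X A D 1 v (r 1))"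
  define O' where "O' = (\<Prod>i=1..j. outer_sum X A D i (m i) (m (Suc i)) (r i) (r (Suc i)))"
  define I' where "I' = (\<Prod>i=1..j. inner_sum X A D i (m i) (m (Suc i)) (r i) (r (Suc i)))"
  define B where "B = (\<Prod>i=1..Suc j. A (int (m i) + int D - int i + 1))"
  define B2 where "B2 = A (int D + int (m (Suc (Suc j))) - int (Suc j))"
  define p where "p = strip_prod X A D (Suc j) (m (Suc j)) (r (Suc j))"
  define p' where "p' = strip_prod X A D (Suc (Suc j)) (m (Suc (Suc j))) (r (Suc (Suc j)))"
  define o2 where "o2 = outer_sum X A D (Suc j) (m (Suc j)) (m (Suc (Suc j))) (r (Suc j)) (r (Suc (Suc j)))"
  have IH: "S * O' * e = X D * B * I' * p"
    using Suc by (simp add: S_def O'_def I'_def B_def e_def p_def)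
  have H2: "o2 * e' = p' * H * B2 * e" using H(2) by (simp only: o2_def e'_def p'_def B2_def e_def)
  have split: "(\<Prod>i=1..Suc (Suc j). g i) = (\<Prod>i=1..Suc j. g i) * g (Suc (Suc j))" for g :: "nat \<Rightarrow> 'a"
    by simp
  have eq': "int (m (Suc (Suc j))) + int D - int (Suc (Suc j)) + 1 = int D + int (m (Suc (Suc j))) - int (Suc j)"
    by simp
  have B2: "(\<Prod>i=1..Suc (Suc j). A (int (m i) + int D - int i + 1)) = B * B2"
    unfolding B_def B2_def split eq' ..
  have O2: "(\<Prod>i=1..Suc j. outer_sum X A D i (m i) (m (Suc i)) (r i) (r (Suc i))) = O' * o2"
    by (simp add: O'_def o2_def)
  have I2: "(\<Prod>i=1..Suc j. inner_sum X A D i (m i) (m (Suc i)) (r i) (r (Suc i))) = I' * (p * H)"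
    by (simp add: I'_def H(1) p_def)
  have "S * (O' * o2) * e' = S * O' * (o2 * e')" by (simp only: mult.assoc)
  also have "\<dots> = (S * O' * e) * p' * H * B2" unfolding H2 by (simp only: ac_simps)
  also have "\<dots> = X D * (B * B2) * (I' * (p * H)) * p'" unfolding IH by (simp only: ac_simps)
  finally show ?case unfolding B2 O2 I2 S_def e'_def p'_def .
qed

section \<open>Coefficients as products over the rows\<close>

lemma groth_0 [simp]: "groth X A 0 m = 1"
proof -
  have "svt 0 m = {\<lambda>_. {}}" by (auto simp: svt_def)
  then show ?thesis by (simp add: groth_def cells_def)
qed

lemma finite_rook_extensions [simp]: "finite (rook_extensions d m)"
proof -
  have "finite {n. m i \<le> n \<and> n \<le> Suc (m i) \<and> (1 < i \<longrightarrow> n \<le> m (i - 1))}" for i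
    by (rule finite_subset[of _ "{..Suc (m i)}"]) auto
  then show ?thesis unfolding rook_extensions_def by (intro finite_PiE) auto
qed

lemma rook_extensions_dec:
  assumes "v \<in> rook_extensions d m"
  shows "dec d v"
  unfolding dec_def
proof (intro allI impI)
  fix i assume i: "1 \<le> i" "i < d"
  then have "m i \<le> v i" "v (Suc i) \<le> m i"
    using assms by (auto simp: rook_extensions_def PiE_iff dest: bspec[of _ _ i] bspec[of _ _ "Suc i"])
  then show "v (Suc i) \<le> v i" by simp
qed

text \<open>Reading the column bound as \<open>p (Suc i) \<le> k i\<close> makes every condition
  involve a single \<open>k i\<close>. Row d + 1 of \<open>p\<close> counts as empty, which makes
  the bound in the last row trivial.\<close>

lemma rook_extensions_iff:
  assumes "p \<in> {1..d} \<rightarrow>\<^sub>E B"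
  shows "p \<in> rook_extensions d k \<longleftrightarrow>
    (\<forall>i\<in>{1..d}. k i \<le> p i \<and> p i \<le> Suc (k i) \<and> (p(Suc d := 0)) (Suc i) \<le> k i)"
    (is "?L \<longleftrightarrow> ?R")
proof
  assume L: ?L
  show ?R
  proof
    fix i assume i: "i \<in> {1..d}"
    then have "k i \<le> p i \<and> p i \<le> Suc (k i)" using L by (auto simp: rook_extensions_def PiE_iff)
    moreover have "(p(Suc d := 0)) (Suc i) \<le> k i"
      using L i by (cases "i = d") (auto simp: rook_extensions_def PiE_iff dest: bspec[of _ _ "Suc i"])
    ultimately show "k i \<le> p i \<and> p i \<le> Suc (k i) \<and> (p(Suc d := 0)) (Suc i) \<le> k i" by blast
  qed
next
  assume R: ?R
  have "p i \<le> k (i - 1)" if "i \<in> {1..d}" "1 < i" for i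
  proof -
    have "i - 1 \<in> {1..d}" "Suc (i - 1) = i" "i \<noteq> Suc d" using that by auto
    then show ?thesis using R[rule_format, of "i - 1"] by simp
  qed
  then show ?L using R assms by (auto simp: rook_extensions_def PiE_iff)
qed

lemma inner_sum_prod:
  assumes p: "p \<in> {1..d} \<rightarrow>\<^sub>E B"
  shows "(\<Sum>k\<in>interlacing d m. if p \<in> rook_extensions d k then
      \<Prod>i=1..d. strip_weight X A (Suc d) i (m i) (k i) * end_weight X A (Suc d) i (k i) (m (Suc i))
        / A (int (Suc d) + int (k i) - int i) else 0)
    = (\<Prod>i=1..d. inner_sum X A (Suc d) i (m i) (m (Suc i)) ((p(Suc d := 0)) i) ((p(Suc d := 0)) (Suc i)))"
proof -
  let ?p = "p(Suc d := 0)"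
  let ?t = "\<lambda>i k. strip_weight X A (Suc d) i (m i) k * end_weight X A (Suc d) i k (m (Suc i))
        / A (int (Suc d) + int k - int i)"
  let ?C = "\<lambda>i k. k \<le> ?p i \<and> ?p i \<le> Suc k \<and> ?p (Suc i) \<le> k"
  have "(if p \<in> rook_extensions d k then \<Prod>i=1..d. ?t i (k i) else 0)
    = (\<Prod>i=1..d. if ?C i (k i) then ?t i (k i) else 0)" for k
  proof (cases "p \<in> rook_extensions d k")
    case True
    then have "\<forall>i\<in>{1..d}. ?C i (k i)" unfolding rook_extensions_iff[OF p] by auto
    then show ?thesis using True by (auto intro: prod.cong)
  next
    case False
    then obtain i where i: "i \<in> {1..d}" "\<not> ?C i (k i)" unfolding rook_extensions_iff[OF p] by auto
    have "(\<Prod>i=1..d. if ?C i (k i) then ?t i (k i) else 0) = 0"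
    proof (rule prod_zero[OF finite_atLeastAtMost], rule bexI)
      show "(if ?C i (k i) then ?t i (k i) else 0) = 0" by (rule if_not_P[OF i(2)])
    qed (rule i(1))
    then show ?thesis using False by simp
  qed
  then show ?thesis
    unfolding inner_sum_def interlacing_def by (simp only: prod_sum_PiE finite_atLeastAtMost)
qed

lemma outer_sum_prod:
  assumes p: "p \<in> {1..d} \<rightarrow>\<^sub>E B"
  shows "(\<Sum>v\<in>rook_extensions (Suc d) m.
      (\<Prod>i=1..d. strip_weight X A (Suc d) i (v i) (p i) * end_weight X A (Suc d) i (p i) (v (Suc i)))
     * strip_weight X A (Suc d) (Suc d) (v (Suc d)) 0)
    = (\<Sum>v\<in>{m 1, Suc (m 1)}. strip_weight X A (Suc d) 1 v ((p(Suc d := 0)) 1))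
      * (\<Prod>i=1..d. outer_sum X A (Suc d) i (m i) (m (Suc i)) ((p(Suc d := 0)) i) ((p(Suc d := 0)) (Suc i)))"
proof -
  let ?p = "p(Suc d := 0)"
  let ?s = "\<lambda>i v. strip_weight X A (Suc d) i v (?p i)"
  let ?e = "\<lambda>i v. end_weight X A (Suc d) i (?p i) v"
  \<comment> \<open>The factors depending on \<open>v i\<close> are the strip of row i and the end
    of row i - 1; grouped in this way, the sum over \<open>v\<close> factors.\<close>
  let ?h = "\<lambda>i v. (if i = 1 then 1 else ?e (i - 1) v) * ?s i v"
  let ?R = "\<lambda>i. {n. m i \<le> n \<and> n \<le> Suc (m i) \<and> (1 < i \<longrightarrow> n \<le> m (i - 1))}"
  have fin: "finite (?R i)" for i
    by (rule finite_subset[of _ "{..Suc (m i)}"]) auto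
  have "(\<Prod>i=1..d. strip_weight X A (Suc d) i (v i) (p i) * end_weight X A (Suc d) i (p i) (v (Suc i)))
     * strip_weight X A (Suc d) (Suc d) (v (Suc d)) 0 = (\<Prod>i=1..Suc d. ?h i (v i))" for v
  proof -
    have "(\<Prod>i=1..Suc d. ?h i (v i)) = (\<Prod>i=1..Suc d. if i = 1 then 1 else ?e (i - 1) (v i)) * (\<Prod>i=1..Suc d. ?s i (v i))"
      by (rule prod.distrib)
    also have "(\<Prod>i=1..Suc d. if i = 1 then 1 else ?e (i - 1) (v i)) = (\<Prod>i=1..d. ?e i (v (Suc i)))"
      by (subst prod.atLeast_Suc_atMost, simp, simp del: prod.cl_ivl_Suc fun_upd_apply
        add: prod.shift_bounds_cl_Suc_ivl)
    also have "\<dots> = (\<Prod>i=1..d. end_weight X A (Suc d) i (p i) (v (Suc i)))"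
      by (rule prod.cong) auto
    also have "(\<Prod>i=1..Suc d. ?s i (v i))
      = (\<Prod>i=1..d. ?s i (v i)) * strip_weight X A (Suc d) (Suc d) (v (Suc d)) 0"
      by simp
    also have "(\<Prod>i=1..d. ?s i (v i)) = (\<Prod>i=1..d. strip_weight X A (Suc d) i (v i) (p i))"
      by (rule prod.cong) auto
    finally show ?thesis
      unfolding prod.distrib[of "\<lambda>i. strip_weight X A (Suc d) i (v i) (p i)"] by (simp only: ac_simps)
  qed
  then have "(\<Sum>v\<in>rook_extensions (Suc d) m.
      (\<Prod>i=1..d. strip_weight X A (Suc d) i (v i) (p i) * end_weight X A (Suc d) i (p i) (v (Suc i)))
     * strip_weight X A (Suc d) (Suc d) (v (Suc d)) 0) = (\<Prod>i=1..Suc d. \<Sum>v\<in>?R i. ?h i v)"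
    unfolding rook_extensions_def using fin by (simp only: prod_sum_PiE finite_atLeastAtMost)
  also have "\<dots> = (\<Sum>v\<in>?R 1. ?h 1 v) * (\<Prod>i=1..d. \<Sum>v\<in>?R (Suc i). ?h (Suc i) v)"
    by (subst prod.atLeast_Suc_atMost, simp, simp del: prod.cl_ivl_Suc fun_upd_apply
        add: prod.shift_bounds_cl_Suc_ivl)
  also have "(\<Prod>i=1..d. \<Sum>v\<in>?R (Suc i). ?h (Suc i) v)
     = (\<Prod>i=1..d. outer_sum X A (Suc d) i (m i) (m (Suc i)) (?p i) (?p (Suc i)))"
    by (rule prod.cong) (auto simp: outer_sum_def intro!: sum.cong)
  also have "?R 1 = {m 1, Suc (m 1)}" by auto
  finally show ?thesis by (simp del: fun_upd_apply)
qed

text \<open>If some part of \<open>p\<close> exceeds that of \<open>m\<close> by more than 1, both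
  sides vanish. Otherwise this is the telescoped identity over all rows; row d + 1 of
  \<open>p\<close> is empty, so the last \<open>excess\<close> is 1.\<close>

lemma outer_inner_sums:
  fixes X :: "nat \<Rightarrow> 'a::field"
  assumes A: "\<And>k. A k \<noteq> 0" and m: "dec (Suc d) m" and p: "p \<in> {1..d} \<rightarrow>\<^sub>E B"
  shows "(\<Sum>v\<in>rook_extensions (Suc d) m.
      (\<Prod>i=1..d. strip_weight X A (Suc d) i (v i) (p i) * end_weight X A (Suc d) i (p i) (v (Suc i)))
     * strip_weight X A (Suc d) (Suc d) (v (Suc d)) 0)
   = X (Suc d) * (\<Prod>i=1..Suc d. A (int (m i) + int (Suc d) - int i + 1))
    * strip_weight X A (Suc d) (Suc d) (m (Suc d)) 0
    * (\<Sum>k\<in>interlacing d m. if p \<in> rook_extensions d k then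
      \<Prod>i=1..d. strip_weight X A (Suc d) i (m i) (k i) * end_weight X A (Suc d) i (k i) (m (Suc i))
        / A (int (Suc d) + int (k i) - int i) else 0)"
  unfolding outer_sum_prod[OF p] inner_sum_prod[OF p]
proof -
  define q where "q = p(Suc d := 0)"
  show "(\<Sum>v\<in>{m 1, Suc (m 1)}. strip_weight X A (Suc d) 1 v (q 1))
      * (\<Prod>i=1..d. outer_sum X A (Suc d) i (m i) (m (Suc i)) (q i) (q (Suc i)))
    = X (Suc d) * (\<Prod>i=1..Suc d. A (int (m i) + int (Suc d) - int i + 1))
    * strip_weight X A (Suc d) (Suc d) (m (Suc d)) 0
    * (\<Prod>i=1..d. inner_sum X A (Suc d) i (m i) (m (Suc i)) (q i) (q (Suc i)))"
  proof (cases "\<forall>i. 1 \<le> i \<longrightarrow> i \<le> Suc d \<longrightarrow> q i \<le> Suc (m i)")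
    case True
    have q: "q (Suc d) = 0" by (simp add: q_def)
    have "excess X A (Suc d) (Suc d) (m (Suc d)) (q (Suc d)) = 1"
      by (simp add: q excess_def)
    moreover have "strip_prod X A (Suc d) (Suc d) (m (Suc d)) (q (Suc d))
      = strip_weight X A (Suc d) (Suc d) (m (Suc d)) 0"
      by (simp add: q strip_weight_same)
    ultimately show ?thesis
      using outer_inner_product[where A = A and X = X and r = q and j = d, OF A m] True by (simp del: prod.cl_ivl_Suc add: ac_simps)
  next
    case False
    then obtain i where i: "1 \<le> i" "i \<le> Suc d" "Suc (m i) < q i" by (auto simp: not_le)
    have "i \<noteq> Suc d" using i by (auto simp: q_def)
    then have id: "i \<in> {1..d}" using i by simp
    have "inner_sum X A (Suc d) i (m i) (m (Suc i)) (q i) (q (Suc i)) = 0"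
      using i by (auto simp: inner_sum_def intro!: sum.neutral)
    then have I: "(\<Prod>i=1..d. inner_sum X A (Suc d) i (m i) (m (Suc i)) (q i) (q (Suc i))) = 0"
      using id by (intro prod_zero) auto
    have "(\<Sum>v\<in>{m 1, Suc (m 1)}. strip_weight X A (Suc d) 1 v (q 1)) = 0
      \<or> (\<Prod>i=1..d. outer_sum X A (Suc d) i (m i) (m (Suc i)) (q i) (q (Suc i))) = 0"
    \<comment> \<open>\<open>outer_sum\<close> at index i - 1 carries the strip of row i; for row 1
      that strip sits in the separate sum.\<close>
    proof (cases "i = 1")
      case True
      then show ?thesis using i by (simp add: strip_weight_def)
    next
      case False
      then have "i - 1 \<in> {1..d}" "Suc (i - 1) = i" using id by auto
      moreover have "outer_sum X A (Suc d) (i - 1) (m (i - 1)) (m i) (q (i - 1)) (q i) = 0"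
        using i by (auto simp: outer_sum_def strip_weight_def intro!: sum.neutral)
      ultimately have "(\<Prod>i=1..d. outer_sum X A (Suc d) i (m i) (m (Suc i)) (q i) (q (Suc i))) = 0"
        by (intro prod_zero) (auto intro!: bexI[of _ "i - 1"])
      then show ?thesis by blast
    qed
    then show ?thesis unfolding I by auto
  qed
qed

lemma interlacing_dec:
  assumes "k \<in> interlacing d m"
  shows "dec d k"
  unfolding dec_def
proof (intro allI impI)
  fix i assume i: "1 \<le> i" "i < d"
  then have "m (Suc i) \<le> k i" "k (Suc i) \<le> m (Suc i)"
    using assms by (auto simp: interlacing_def PiE_iff dest: bspec[of _ _ i] bspec[of _ _ "Suc i"])
  then show "k (Suc i) \<le> k i" by simp
qed

theorem groth_pieri:
  fixes X :: "nat \<Rightarrow> 'a::field"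
  assumes A: "\<And>k. A k \<noteq> 0"
  shows "dec d m \<Longrightarrow> groth X A d m * (\<Prod>i=1..d. X i * A (int (m i) + int d - int i + 1))
    = (\<Sum>v\<in>rook_extensions d m. groth X A d v)"
proof (induction d arbitrary: m)
  case 0
  then show ?case by (simp add: rook_extensions_def)
next
  case (Suc d)
  note m = Suc.prems
  obtain N where N: "\<And>i. i \<in> {1..Suc d} \<Longrightarrow> Suc (m i) \<le> N"
  proof (rule that)
    fix i assume "i \<in> {1..Suc d}"
    then show "Suc (m i) \<le> (\<Sum>i\<in>{1..Suc d}. Suc (m i))" by (intro member_le_sum) auto
  qed
  let ?B = "{1..d} \<rightarrow>\<^sub>E {..N}"
  let ?W = "\<lambda>v k. (\<Prod>i=1..d. strip_weight X A (Suc d) i (v i) (k i) * end_weight X A (Suc d) i (k i) (v (Suc i)))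
     * strip_weight X A (Suc d) (Suc d) (v (Suc d)) 0"
  \<comment> \<open>The division compensates the \<open>A\<close> factors that the induction
    hypothesis attaches to \<open>groth X A d k\<close>.\<close>
  let ?V = "\<lambda>k. \<Prod>i=1..d. strip_weight X A (Suc d) i (m i) (k i) * end_weight X A (Suc d) i (k i) (m (Suc i))
        / A (int (Suc d) + int (k i) - int i)"
  define P where "P = (\<Prod>i=1..Suc d. A (int (m i) + int (Suc d) - int i + 1))"
  define s where "s = strip_weight X A (Suc d) (Suc d) (m (Suc d)) 0"
  have fB: "finite ?B" by (auto intro: finite_PiE)
  have fI: "finite (interlacing d m)" by (auto simp: interlacing_def intro!: finite_PiE)
  have rB: "rook_extensions d k \<subseteq> ?B" if k: "k \<in> interlacing d m" for k
    unfolding rook_extensions_def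
  proof (rule PiE_mono)
    fix i assume i: "i \<in> {1..d}"
    then have "k i \<le> m i" using k by (auto simp: interlacing_def PiE_iff)
    then show "{n. k i \<le> n \<and> n \<le> Suc (k i) \<and> (1 < i \<longrightarrow> n \<le> k (i - 1))} \<subseteq> {..N}"
      using N[of i] i by auto
  qed
  have "groth X A (Suc d) m * (\<Prod>i=1..Suc d. X i * A (int (m i) + int (Suc d) - int i + 1))
    = (\<Sum>k\<in>interlacing d m. groth X A d k * ?W m k) * (\<Prod>i=1..Suc d. X i) * P"
    unfolding groth_branch[OF m] prod.distrib P_def by (simp only: mult.assoc)
  also have "\<dots> = (\<Sum>k\<in>interlacing d m. (\<Sum>p\<in>rook_extensions d k. groth X A d p) * ?V k * (X (Suc d) * P * s))"
    unfolding sum_distrib_right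
  proof (rule sum.cong[OF refl])
    fix k assume k: "k \<in> interlacing d m"
    let ?a = "\<Prod>i=1..d. A (int (Suc d) + int (k i) - int i)"
    have "(\<Prod>i=1..d. X i * A (int (k i) + int d - int i + 1)) = (\<Prod>i=1..d. X i) * ?a"
      unfolding prod.distrib[symmetric] by (rule prod.cong) (auto simp: algebra_simps)
    then have IH: "(\<Sum>p\<in>rook_extensions d k. groth X A d p) = groth X A d k * ((\<Prod>i=1..d. X i) * ?a)"
      using Suc.IH[OF interlacing_dec[OF k]] by simp
    have V: "?V k * ?a = (\<Prod>i=1..d. strip_weight X A (Suc d) i (m i) (k i) * end_weight X A (Suc d) i (k i) (m (Suc i)))"
      unfolding prod.distrib[symmetric] using A by (intro prod.cong) auto
    have "groth X A d k * ?W m k * (\<Prod>i=1..Suc d. X i) * P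
      = groth X A d k * (?V k * ?a * s) * ((\<Prod>i=1..d. X i) * X (Suc d)) * P"
      unfolding V s_def by simp
    also have "\<dots> = (groth X A d k * ((\<Prod>i=1..d. X i) * ?a)) * ?V k * (X (Suc d) * P * s)"
      by (simp only: ac_simps)
    also have "\<dots> = (\<Sum>p\<in>rook_extensions d k. groth X A d p) * ?V k * (X (Suc d) * P * s)"
      by (simp only: IH)
    finally show "groth X A d k * ?W m k * (\<Prod>i=1..Suc d. X i) * P
      = (\<Sum>p\<in>rook_extensions d k. groth X A d p * ?V k * (X (Suc d) * P * s))"
      by (simp only: sum_distrib_right)
  qed
  also have "\<dots> = (\<Sum>k\<in>interlacing d m. \<Sum>p\<in>?B. if p \<in> rook_extensions d k
      then groth X A d p * ?V k * (X (Suc d) * P * s) else 0)"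
  proof (rule sum.cong[OF refl])
    fix k assume k: "k \<in> interlacing d m"
    show "(\<Sum>p\<in>rook_extensions d k. groth X A d p) * ?V k * (X (Suc d) * P * s)
      = (\<Sum>p\<in>?B. if p \<in> rook_extensions d k then groth X A d p * ?V k * (X (Suc d) * P * s) else 0)"
      unfolding sum_distrib_right sum.inter_restrict[OF fB, symmetric]
      using rB[OF k] by (simp add: Int_absorb1)
  qed
  also have "\<dots> = (\<Sum>p\<in>?B. \<Sum>k\<in>interlacing d m. if p \<in> rook_extensions d k
      then groth X A d p * ?V k * (X (Suc d) * P * s) else 0)"
    by (rule sum.swap)
  also have "\<dots> = (\<Sum>p\<in>?B. groth X A d p * (X (Suc d) * P * s *
      (\<Sum>k\<in>interlacing d m. if p \<in> rook_extensions d k then ?V k else 0)))"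
    unfolding sum_distrib_left by (intro sum.cong refl) auto
  \<comment> \<open>Here the coefficients of \<open>groth X A d p\<close> are matched; what remains
    is the branching rule of each \<open>v\<close>, read backwards.\<close>
  also have "\<dots> = (\<Sum>p\<in>?B. groth X A d p * (\<Sum>v\<in>rook_extensions (Suc d) m. ?W v p))"
    by (rule sum.cong[OF refl]) (simp only: outer_inner_sums[OF A m] P_def s_def)
  also have "\<dots> = (\<Sum>v\<in>rook_extensions (Suc d) m. \<Sum>p\<in>?B. groth X A d p * ?W v p)"
    unfolding sum_distrib_left by (rule sum.swap)
  also have "\<dots> = (\<Sum>v\<in>rook_extensions (Suc d) m. groth X A (Suc d) v)"
  proof (rule sum.cong[OF refl])
    fix v assume v: "v \<in> rook_extensions (Suc d) m"
    have "v i \<le> N" if "1 \<le> i" "i \<le> d" for i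
    proof -
      have "v i \<le> Suc (m i)" using v that by (auto simp: rook_extensions_def PiE_iff)
      then show ?thesis using N[of i] that by simp
    qed
    from groth_branch_bounded[OF rook_extensions_dec[OF v] this, of X A]
    show "(\<Sum>p\<in>?B. groth X A d p * ?W v p) = groth X A (Suc d) v"
      by (simp only: mult.assoc)
  qed
  finally show ?case .
qed

subsection \<open>Evaluation at the dual point\<close>

lemma groth_cong:
  assumes "\<And>r. 1 \<le> r \<Longrightarrow> r \<le> d \<Longrightarrow> X r = Y r"
  shows "groth X A d m = groth Y A d m"
  unfolding groth_def cell_weight_def
proof (intro sum.cong prod.cong refl)
  fix S c r assume "S \<in> svt d m" "r \<in> S c"
  then have "X r = Y r" using assms svtD(1,2) by metis
  then show "X r * A (int r + int (snd c) - int (fst c)) - 1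
    = Y r * A (int r + int (snd c) - int (fst c)) - 1" by simp
qed

lemma groth_cong_shape:
  assumes "\<And>i. i \<in> {1..d} \<Longrightarrow> m i = n i"
  shows "groth X A d m = groth X A d n"
proof -
  have "cells d m = cells d n" using assms by (auto simp: cells_def)
  then show ?thesis by (simp add: groth_def svt_def)
qed

text \<open>The point with \<open>x\<^sub>r\<close> the formal-group inverse of \<open>a\<close> at
  index \<open>l (d + 1 - r) + r\<close>, so that \<open>X A = 1\<close> there. Reversing the rows
  pairs the last variable with row 1: dropping that variable drops the largest part of
  \<open>l\<close>.\<close>

definition dual_point :: "(int \<Rightarrow> 'a::field) \<Rightarrow> nat \<Rightarrow> (nat \<Rightarrow> nat) \<Rightarrow> nat \<Rightarrow> 'a" where
  "dual_point A d l r = 1 / A (int (l (d + 1 - r)) + int r)"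

lemma groth_dual_point_shift:
  "groth (dual_point A (Suc d) l) A d k = groth (dual_point A d (\<lambda>i. l (Suc i))) A d k"
proof (rule groth_cong)
  fix r assume r: "1 \<le> r" "r \<le> d"
  then have "Suc d + 1 - r = Suc (d + 1 - r)" by simp
  then show "dual_point A (Suc d) l r = dual_point A d (\<lambda>i. l (Suc i)) r"
    by (simp add: dual_point_def)
qed

lemma dual_point_top: "dual_point A (Suc d) l (Suc d) = 1 / A (int (l 1) + int (Suc d))"
  by (simp add: dual_point_def)

lemma dec_shift: "dec (Suc d) l \<Longrightarrow> dec d (\<lambda>i. l (Suc i))"
  by (simp add: dec_def)

text \<open>In a nonzero branch term the induction hypothesis bounds \<open>k i\<close> by
  \<open>l (Suc i)\<close>, hence also \<open>m (Suc i)\<close>. Were \<open>m 1 > l 1\<close>, the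
  strip in row 1 would contain column \<open>l 1 + 1\<close>, whose weight vanishes by the choice of
  the last variable.\<close>

lemma groth_vanishing:
  fixes A :: "int \<Rightarrow> 'a::field"
  assumes A: "\<And>k. A k \<noteq> 0"
  shows "dec d l \<Longrightarrow> dec d m \<Longrightarrow> groth (dual_point A d l) A d m \<noteq> 0 \<Longrightarrow> i \<in> {1..d} \<Longrightarrow> m i \<le> l i"
proof (induction d arbitrary: l m i)
  case 0
  then show ?case by simp
next
  case (Suc d)
  let ?X = "dual_point A (Suc d) l"
  obtain k where k: "k \<in> interlacing d m"
    and nz: "groth ?X A d k
     * (\<Prod>i=1..d. strip_weight ?X A (Suc d) i (m i) (k i) * end_weight ?X A (Suc d) i (k i) (m (Suc i)))
     * strip_weight ?X A (Suc d) (Suc d) (m (Suc d)) 0 \<noteq> 0"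
    using Suc.prems(3) unfolding groth_branch[OF Suc.prems(2)] by (meson sum.not_neutral_contains_not_neutral)
  have "groth (dual_point A d (\<lambda>i. l (Suc i))) A d k \<noteq> 0"
    using nz unfolding groth_dual_point_shift by auto
  from Suc.IH[OF dec_shift[OF Suc.prems(1)] interlacing_dec[OF k] this]
  have le: "k i \<le> l (Suc i)" if "i \<in> {1..d}" for i using that by blast
  have strip0: "strip_weight ?X A (Suc d) 1 (m 1) n = 0" if "n \<le> l 1" "l 1 < m 1" for n
  proof -
    have j: "Suc (l 1) \<in> {n<..m 1}" using that by auto
    have eq: "int (Suc d) + int (Suc (l 1)) - int 1 = int (l 1) + int (Suc d)" by simp
    have "?X (Suc d) * A (int (Suc d) + int (Suc (l 1)) - int 1) - 1 = 0"
      unfolding eq dual_point_top using A by simp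
    then have "(\<Prod>j\<in>{n<..m 1}. ?X (Suc d) * A (int (Suc d) + int j - int 1) - 1) = 0"
      using j by (intro prod_zero) blast+
    then show ?thesis by (simp only: strip_weight_def if_cancel)
  qed
  have first: "m 1 \<le> l 1"
  proof (rule ccontr)
    assume "\<not> m 1 \<le> l 1"
    then have lt: "l 1 < m 1" by simp
    show False
    proof (cases "d = 0")
      case True
      then show False using nz strip0[OF _ lt, of 0] by simp
    next
      case False
      then have "k 1 \<le> l 1" using le[of 1] decD[OF Suc.prems(1), of 1] by simp
      from strip0[OF this lt]
      have "(\<Prod>i=1..d. strip_weight ?X A (Suc d) i (m i) (k i) * end_weight ?X A (Suc d) i (k i) (m (Suc i))) = 0"
        using False by (intro prod_zero bexI[of _ 1]) auto
      then show False using nz by simp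
    qed
  qed
  show ?case
  proof (cases "i = 1")
    case True
    then show ?thesis using first by simp
  next
    case False
    then have i: "i - 1 \<in> {1..d}" "Suc (i - 1) = i" using Suc.prems(4) by auto
    then have "m i \<le> k (i - 1)" using k by (auto simp: interlacing_def PiE_iff dest: bspec[of _ _ "i - 1"])
    then show ?thesis using le[OF i(1)] i(2) by simp
  qed
qed

lemma dec_le:
  assumes "dec d m" "1 \<le> i" "i \<le> j" "j \<le> d"
  shows "m j \<le> m i"
  using assms(3,4)
proof (induction j rule: dec_induct)
  case (step j)
  then have "m (Suc j) \<le> m j" using assms by (intro decD[OF assms(1)]) auto
  then show ?case using step by simp
qed simp

section \<open>The value at the shape itself\<close>

definition col_length :: "nat \<Rightarrow> (nat \<Rightarrow> nat) \<Rightarrow> nat \<Rightarrow> nat" where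
  "col_length d l j = card {i\<in>{1..d}. j \<le> l i}"

lemma col_length_eq:
  assumes l: "dec d l" and i: "1 \<le> i" "i \<le> d" "j \<le> l i" and n: "i < d \<Longrightarrow> l (Suc i) < j"
  shows "col_length d l j = i"
proof -
  have "{i\<in>{1..d}. j \<le> l i} = {1..i}"
  proof (intro equalityI subsetI)
    fix x assume x: "x \<in> {i\<in>{1..d}. j \<le> l i}"
    show "x \<in> {1..i}"
    proof (rule ccontr)
      assume "x \<notin> {1..i}"
      then have "l x \<le> l (Suc i)" "l (Suc i) < j" using x i by (auto intro!: dec_le[OF l] n)
      then show False using x by simp
    qed
  next
    fix x assume "x \<in> {1..i}"
    then show "x \<in> {i\<in>{1..d}. j \<le> l i}" using i dec_le[OF l, of x i] by auto
  qed
  then show ?thesis by (simp add: col_length_def)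
qed

lemma col_length_shift:
  assumes "j \<le> l 1"
  shows "col_length (Suc d) l j = Suc (col_length d (\<lambda>i. l (Suc i)) j)"
proof -
  have "{i\<in>{1..Suc d}. j \<le> l i} = insert 1 (Suc ` {i\<in>{1..d}. j \<le> l (Suc i)})"
  proof (intro equalityI subsetI)
    fix x assume x: "x \<in> {i\<in>{1..Suc d}. j \<le> l i}"
    then show "x \<in> insert 1 (Suc ` {i\<in>{1..d}. j \<le> l (Suc i)})" by (cases x) (auto simp: image_iff)
  qed (use assms in auto)
  moreover have "1 \<notin> Suc ` {i\<in>{1..d}. j \<le> l (Suc i)}" by auto
  ultimately have "card {i\<in>{1..Suc d}. j \<le> l i} = Suc (card (Suc ` {i\<in>{1..d}. j \<le> l (Suc i)}))"
    by (simp only: card_insert_disjoint finite_imageI finite_Collect_conjI finite_atLeastAtMost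
        Collect_mem_eq simp_thms)
  then show ?thesis
    unfolding col_length_def by (simp add: card_image)
qed

lemma prod_intervals:
  fixes f :: "nat \<Rightarrow> 'a::comm_monoid_mult"
  assumes l: "dec (Suc d) l"
  shows "(\<Prod>j\<in>{l (Suc d)<..l 1}. f j) = (\<Prod>i=1..d. \<Prod>j\<in>{l (Suc i)<..l i}. f j)"
  using l
proof (induction d)
  case (Suc d)
  have d: "dec (Suc d) l" using Suc.prems by (simp add: dec_def)
  have "l (Suc (Suc d)) \<le> l (Suc d)" "l (Suc d) \<le> l 1"
    using dec_le[OF Suc.prems] by auto
  then have "{l (Suc (Suc d))<..l 1} = {l (Suc d)<..l 1} \<union> {l (Suc (Suc d))<..l (Suc d)}" by auto
  then have "(\<Prod>j\<in>{l (Suc (Suc d))<..l 1}. f j) = (\<Prod>j\<in>{l (Suc d)<..l 1}. f j) * (\<Prod>j\<in>{l (Suc (Suc d))<..l (Suc d)}. f j)"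
    by (simp add: prod.union_disjoint)
  then show ?case using Suc.IH[OF d] by simp
qed simp

text \<open>Interlacing forces \<open>k i \<ge> l (Suc i)\<close> and vanishing forces
  \<open>k i \<le> l (Suc i)\<close>, so one branch survives: \<open>l\<close> without row 1. The
  removed cells are the bottom cells of the columns, one per column, and supply the factors indexed
  by row 1.\<close>

lemma groth_diagonal:
  fixes A :: "int \<Rightarrow> 'a::field"
  assumes A: "\<And>k. A k \<noteq> 0"
  shows "dec d l \<Longrightarrow> groth (dual_point A d l) A d l
    = (\<Prod>i=1..d. \<Prod>j=1..l i. A (int d + int j - int (col_length d l j)) / A (int (l i) + int d - int i + 1) - 1)"
proof (induction d arbitrary: l)
  case 0
  then show ?case by simp
next
  case (Suc d)
  let ?X = "dual_point A (Suc d) l"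
  let ?l = "\<lambda>i. l (Suc i)"
  let ?k = "\<lambda>i\<in>{1..d}. l (Suc i)"
  note l = Suc.prems
  let ?f = "\<lambda>k. groth ?X A d k
     * ((\<Prod>i=1..d. strip_weight ?X A (Suc d) i (l i) (k i) * end_weight ?X A (Suc d) i (k i) (l (Suc i)))
     * strip_weight ?X A (Suc d) (Suc d) (l (Suc d)) 0)"
  have kI: "?k \<in> interlacing d l" using decD[OF l] by (auto simp: interlacing_def)
  have "groth ?X A (Suc d) l = (\<Sum>k\<in>{?k}. ?f k)"
    unfolding groth_branch[OF l] mult.assoc
  proof (rule sum.mono_neutral_right)
    show "finite (interlacing d l)" by (auto simp: interlacing_def intro!: finite_PiE)
    show "{?k} \<subseteq> interlacing d l" using kI by simp
    show "\<forall>k\<in>interlacing d l - {?k}. ?f k = 0"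
    proof (intro ballI, rule ccontr)
      fix k assume k: "k \<in> interlacing d l - {?k}" and nz: "?f k \<noteq> 0"
      then have "groth (dual_point A d ?l) A d k \<noteq> 0"
        unfolding groth_dual_point_shift by auto
      then have "k i \<le> l (Suc i)" if "i \<in> {1..d}" for i
        using groth_vanishing[where A = A and l = ?l, OF A dec_shift[OF l] interlacing_dec] that k by blast
      moreover have "l (Suc i) \<le> k i" if "i \<in> {1..d}" for i
        using k that by (auto simp: interlacing_def PiE_iff)
      ultimately have "k i = ?k i" if "i \<in> {1..d}" for i using that by (simp add: le_antisym)
      moreover have "k i = ?k i" if "i \<notin> {1..d}" for i
        using k that by (auto simp: interlacing_def PiE_iff extensional_def)
      ultimately have "k = ?k" by blast
      then show False using k by blast
    qed
  qed
  then have sum: "groth ?X A (Suc d) l = ?f ?k" by simp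
  have "groth ?X A d ?k = groth (dual_point A d ?l) A d ?l"
    unfolding groth_dual_point_shift by (rule groth_cong_shape) simp
  also have "\<dots> = (\<Prod>i=1..d. \<Prod>j=1..?l i. A (int d + int j - int (col_length d ?l j)) / A (int (?l i) + int d - int i + 1) - 1)"
    by (rule Suc.IH[OF dec_shift[OF l]])
  also have "\<dots> = (\<Prod>i=1..d. \<Prod>j=1..l (Suc i). A (int (Suc d) + int j - int (col_length (Suc d) l j)) / A (int (l (Suc i)) + int (Suc d) - int (Suc i) + 1) - 1)"
  proof (intro prod.cong refl)
    fix i j assume i: "i \<in> {1..d}" and j: "j \<in> {1..l (Suc i)}"
    have "j \<le> l 1" using j i dec_le[OF l, of 1 "Suc i"] by auto
    from col_length_shift[where l = l and d = d, OF this]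
    show "A (int d + int j - int (col_length d ?l j)) / A (int (?l i) + int d - int i + 1) - 1
      = A (int (Suc d) + int j - int (col_length (Suc d) l j)) / A (int (l (Suc i)) + int (Suc d) - int (Suc i) + 1) - 1"
      by (simp add: algebra_simps)
  qed
  finally have rest: "groth ?X A d ?k = \<dots>" .
  have row: "(\<Prod>i=1..d. strip_weight ?X A (Suc d) i (l i) (?k i) * end_weight ?X A (Suc d) i (?k i) (l (Suc i)))
     * strip_weight ?X A (Suc d) (Suc d) (l (Suc d)) 0
    = (\<Prod>j=1..l 1. A (int (Suc d) + int j - int (col_length (Suc d) l j)) / A (int (l 1) + int (Suc d) - int 1 + 1) - 1)"
    (is "?P * ?Q = (\<Prod>j=1..l 1. ?g j)")
  proof -
    \<comment> \<open>The columns \<open>l (Suc i) < j \<le> l i\<close> are those of length i, so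
      \<open>col_length\<close> replaces the row index uniformly.\<close>
    have g: "?X (Suc d) * A (int (Suc d) + int j - int i) - 1 = ?g j"
      if "i \<in> {1..Suc d}" "j \<le> l i" "i < Suc d \<Longrightarrow> l (Suc i) < j" for i j
      using col_length_eq[OF l, of i j] that unfolding dual_point_top by (simp add: algebra_simps)
    have "?P = (\<Prod>i=1..d. \<Prod>j\<in>{l (Suc i)<..l i}. ?g j)"
    proof (intro prod.cong refl)
      fix i assume i: "i \<in> {1..d}"
      have "(\<Prod>j\<in>{l (Suc i)<..l i}. ?X (Suc d) * A (int (Suc d) + int j - int i) - 1)
        = (\<Prod>j\<in>{l (Suc i)<..l i}. ?g j)"
        using i by (intro prod.cong refl g) auto
      then show "strip_weight ?X A (Suc d) i (l i) (?k i) * end_weight ?X A (Suc d) i (?k i) (l (Suc i))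
        = (\<Prod>j\<in>{l (Suc i)<..l i}. ?g j)"
        using i decD[OF l, of i] by (simp add: strip_weight_def end_weight_def)
    qed
    also have "\<dots> = (\<Prod>j\<in>{l (Suc d)<..l 1}. ?g j)" by (rule prod_intervals[OF l, symmetric])
    finally have P: "?P = \<dots>" .
    have "?Q = (\<Prod>j\<in>{0<..l (Suc d)}. ?X (Suc d) * A (int (Suc d) + int j - int (Suc d)) - 1)"
      by (simp add: strip_weight_def)
    also have "\<dots> = (\<Prod>j\<in>{0<..l (Suc d)}. ?g j)"
      by (intro prod.cong refl g) auto
    finally have Q: "?Q = \<dots>" .
    have "{1..l 1} = {l (Suc d)<..l 1} \<union> {0<..l (Suc d)}"
      using dec_le[OF l, of 1 "Suc d"] by auto
    then show ?thesis unfolding P Q by (simp add: prod.union_disjoint)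
  qed
  have split: "(\<Prod>i=1..Suc d. F i) = (\<Prod>i=1..d. F (Suc i)) * F 1" for F :: "nat \<Rightarrow> 'a"
    by (subst prod.atLeast_Suc_atMost, simp) (simp only: prod.shift_bounds_cl_Suc_ivl One_nat_def mult.commute)
  show ?case unfolding sum rest row split ..
qed

subsection \<open>Increasing tableaux\<close>

definition incr_fillings :: "(nat \<times> nat) set \<Rightarrow> (nat \<times> nat \<Rightarrow> nat) set" where
  "incr_fillings K = {T. (\<forall>c. c \<notin> K \<longrightarrow> T c = 0)
     \<and> (\<forall>i j. (i, j) \<in> K \<and> (i, Suc j) \<in> K \<longrightarrow> T (i, j) < T (i, Suc j))
     \<and> (\<forall>i j. (i, j) \<in> K \<and> (Suc i, j) \<in> K \<longrightarrow> T (i, j) < T (Suc i, j))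
     \<and> (\<exists>n. T ` K = {1..n})}"

definition filled_shape ::
    "nat \<Rightarrow> (nat \<Rightarrow> nat) \<Rightarrow> (nat \<Rightarrow> nat) \<Rightarrow> (nat \<times> nat \<Rightarrow> nat) \<Rightarrow> nat \<Rightarrow> nat \<Rightarrow> nat" where
  "filled_shape d l m T k =
     (\<lambda>i\<in>{1..d}. card {j. (i, j) \<in> cells d m \<or> (i, j) \<in> cells d l - cells d m \<and> T (i, j) < k})"

definition filling_sum ::
    "((nat \<Rightarrow> nat) \<Rightarrow> 'a::field) \<Rightarrow> nat \<Rightarrow> (nat \<Rightarrow> nat) \<Rightarrow> (nat \<Rightarrow> nat) \<Rightarrow> 'a" where
  "filling_sum w d l m = (\<Sum>T\<in>incr_fillings (cells d l - cells d m).
     \<Prod>k=1..card (T ` (cells d l - cells d m)). w (filled_shape d l m T k))"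

text \<open>The shapes that the entries 1 of an increasing tableau can produce.
  \<open>restrict m {1..d}\<close> is the form in which \<open>m\<close> occurs among the
  extensional functions.\<close>

definition rook_steps :: "nat \<Rightarrow> (nat \<Rightarrow> nat) \<Rightarrow> (nat \<Rightarrow> nat) \<Rightarrow> (nat \<Rightarrow> nat) set" where
  "rook_steps d l m = {v \<in> rook_extensions d m. v \<noteq> restrict m {1..d} \<and> (\<forall>i\<in>{1..d}. v i \<le> l i)}"

lemma incr_fillingsD:
  assumes "T \<in> incr_fillings K"
  shows "c \<notin> K \<Longrightarrow> T c = 0"
    "(i, j) \<in> K \<Longrightarrow> (i, Suc j) \<in> K \<Longrightarrow> T (i, j) < T (i, Suc j)"
    "(i, j) \<in> K \<Longrightarrow> (Suc i, j) \<in> K \<Longrightarrow> T (i, j) < T (Suc i, j)"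
    "T ` K = {1..card (T ` K)}"
    "c \<in> K \<Longrightarrow> 1 \<le> T c"
proof -
  show "c \<notin> K \<Longrightarrow> T c = 0" using assms unfolding incr_fillings_def by blast
  show "(i, j) \<in> K \<Longrightarrow> (i, Suc j) \<in> K \<Longrightarrow> T (i, j) < T (i, Suc j)"
    using assms unfolding incr_fillings_def by blast
  show "(i, j) \<in> K \<Longrightarrow> (Suc i, j) \<in> K \<Longrightarrow> T (i, j) < T (Suc i, j)"
    using assms unfolding incr_fillings_def by blast
  obtain n where n: "T ` K = {1..n}" using assms unfolding incr_fillings_def by blast
  then show "T ` K = {1..card (T ` K)}" by simp
  show "c \<in> K \<Longrightarrow> 1 \<le> T c" using n by fastforce
qed

lemma finite_incr_fillings:
  assumes "finite K"
  shows "finite (incr_fillings K)"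
proof (rule finite_subset)
  show "incr_fillings K \<subseteq> {T. \<forall>c. (c \<in> K \<longrightarrow> T c \<in> {..card K}) \<and> (c \<notin> K \<longrightarrow> T c = 0)}"
  proof (intro subsetI CollectI allI conjI impI)
    fix T c assume T: "T \<in> incr_fillings K"
    then show "c \<notin> K \<Longrightarrow> T c = 0" by (rule incr_fillingsD(1))
    assume "c \<in> K"
    then have "T c \<in> {1..card (T ` K)}" using incr_fillingsD(4)[OF T] by blast
    moreover have "card (T ` K) \<le> card K" using assms by (rule card_image_le)
    ultimately show "T c \<in> {..card K}" by simp
  qed
  show "finite {T. \<forall>c. (c \<in> K \<longrightarrow> T c \<in> {..card K}) \<and> (c \<notin> K \<longrightarrow> T c = (0::nat))}"
    using assms by (intro finite_set_of_finite_funs) auto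
qed

context
  fixes d :: nat and l m :: "nat \<Rightarrow> nat"
  assumes l: "dec d l" and m: "dec d m" and le: "\<And>i. i \<in> {1..d} \<Longrightarrow> m i \<le> l i"
begin

text \<open>A cell of the skew shape immediately left of an entry 1 would need a smaller positive
  entry, so the entries 1 prolong the rows of \<open>m\<close> without gaps.\<close>

lemma filled_shape_2_cells:
  assumes T: "T \<in> incr_fillings (cells d l - cells d m)"
  shows "(i, j) \<in> cells d (filled_shape d l m T 2) \<longleftrightarrow>
    (i, j) \<in> cells d m \<or> (i, j) \<in> cells d l - cells d m \<and> T (i, j) = 1"
proof (cases "i \<in> {1..d}")
  case True
  let ?A = "{j. (i, j) \<in> cells d m \<or> (i, j) \<in> cells d l - cells d m \<and> T (i, j) < 2}"
  have A: "?A = {j. (i, j) \<in> cells d m \<or> (i, j) \<in> cells d l - cells d m \<and> T (i, j) = 1}"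
    using incr_fillingsD(5)[OF T, of "(i, _)"] by (intro Collect_cong) force
  have "?A = {1..card ?A}"
  proof (rule downset_eq_interval)
    show "finite ?A" using le[OF True] by (intro finite_subset[of ?A "{..l i}"]) auto
    show "0 \<notin> ?A" by auto
    fix j assume j: "1 \<le> j" "Suc j \<in> ?A"
    show "j \<in> ?A"
    proof (rule ccontr)
      assume n: "j \<notin> ?A"
      then have "(i, j) \<notin> cells d m" "(i, Suc j) \<notin> cells d m" using j(1) True by auto
      then have c: "(i, j) \<in> cells d l - cells d m" "(i, Suc j) \<in> cells d l - cells d m" "T (i, Suc j) < 2"
        using j True by auto
      from incr_fillingsD(2)[OF T c(1,2)] incr_fillingsD(5)[OF T c(1)] c(3) show False by simp
    qed
  qed
  then have "j \<in> ?A \<longleftrightarrow> j \<in> {1..card ?A}" by blast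
  moreover have "filled_shape d l m T 2 i = card ?A" using True by (simp only: filled_shape_def restrict_apply if_True)
  ultimately have "j \<in> ?A \<longleftrightarrow> (i, j) \<in> cells d (filled_shape d l m T 2)" using True by simp
  then show ?thesis unfolding A by blast
qed auto

lemma filled_shape_1:
  assumes T: "T \<in> incr_fillings (cells d l - cells d m)"
  shows "filled_shape d l m T 1 = restrict m {1..d}"
proof
  fix i
  have "{j. (i, j) \<in> cells d m \<or> (i, j) \<in> cells d l - cells d m \<and> T (i, j) < 1} = {1..m i}" if "i \<in> {1..d}"
    using that incr_fillingsD(5)[OF T] by fastforce
  then show "filled_shape d l m T 1 i = restrict m {1..d} i" by (simp add: filled_shape_def)
qed

text \<open>Strict increase forbids two adjacent entries 1 in a row or column, and an entry 1 exists
  because the entries form an interval starting at 1.\<close>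

lemma filled_shape_2_rook:
  assumes T: "T \<in> incr_fillings (cells d l - cells d m)" and ne: "cells d l - cells d m \<noteq> {}"
  shows "filled_shape d l m T 2 \<in> rook_steps d l m"
proof -
  let ?v = "filled_shape d l m T 2"
  note iff = filled_shape_2_cells[OF T]
  have ml: "m i \<le> ?v i" if i: "i \<in> {1..d}" for i
  proof (cases "m i = 0")
    case False
    then have "(i, m i) \<in> cells d ?v" unfolding iff using i by auto
    then show ?thesis by simp
  qed simp
  have vl: "?v i \<le> l i" if i: "i \<in> {1..d}" for i
  proof (cases "?v i = 0")
    case False
    then have "(i, ?v i) \<in> cells d ?v" using i by auto
    then show ?thesis unfolding iff using le[OF i] by auto
  qed simp
  have vm: "?v i \<le> Suc (m i)" if i: "i \<in> {1..d}" for i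
  proof (rule ccontr)
    assume n: "\<not> ?v i \<le> Suc (m i)"
    then have c: "(i, Suc (m i)) \<in> cells d l - cells d m" "(i, Suc (Suc (m i))) \<in> cells d l - cells d m"
      using i vl[OF i] by auto
    have "(i, Suc (Suc (m i))) \<in> cells d ?v" using n i by auto
    then have "T (i, Suc (Suc (m i))) = 1" unfolding iff using c by blast
    then show False using incr_fillingsD(2)[OF T c] incr_fillingsD(5)[OF T c(1)] by simp
  qed
  have vr: "?v i \<le> m (i - 1)" if i: "i \<in> {1..d}" "1 < i" for i
  proof (rule ccontr)
    assume n: "\<not> ?v i \<le> m (i - 1)"
    obtain h where h: "i = Suc h" using i by (cases i) auto
    have "m i \<le> m h" "l i \<le> l h" using i h decD[OF m, of h] decD[OF l, of h] by auto
    then have c: "(h, Suc (m h)) \<in> cells d l - cells d m" "(Suc h, Suc (m h)) \<in> cells d l - cells d m"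
      using i vl[OF i(1)] n h by auto
    have "(Suc h, Suc (m h)) \<in> cells d ?v" using n i h by auto
    then have "T (Suc h, Suc (m h)) = 1" unfolding iff using c by blast
    then show False using incr_fillingsD(3)[OF T c] incr_fillingsD(5)[OF T c(1)] by simp
  qed
  have "?v \<noteq> restrict m {1..d}"
  proof
    assume eq: "?v = restrict m {1..d}"
    obtain c where "c \<in> cells d l - cells d m" using ne by blast
    then have "T ` (cells d l - cells d m) \<noteq> {}" by blast
    then have "1 \<in> T ` (cells d l - cells d m)"
      using incr_fillingsD(4)[OF T] by (metis atLeastAtMost_iff atLeastatMost_empty_iff2 le_refl)
    then obtain x where x: "1 = T x" "x \<in> cells d l - cells d m" by (rule imageE)
    moreover obtain i j where "x = (i, j)" by (cases x)
    ultimately have c: "(i, j) \<in> cells d l - cells d m" "T (i, j) = 1" by simp_all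
    then have "(i, j) \<in> cells d ?v" unfolding iff by blast
    then show False using c unfolding eq by auto
  qed
  moreover have "?v \<in> rook_extensions d m"
    unfolding rook_extensions_def using ml vm vr by (auto simp: PiE_iff filled_shape_def)
  ultimately show ?thesis using vl by (simp add: rook_steps_def)
qed

lemma rook_steps_cells:
  assumes "v \<in> rook_steps d l m"
  shows "cells d m \<subseteq> cells d v" "cells d v \<subseteq> cells d l" "\<exists>c. c \<in> cells d v - cells d m"
    "(i, j) \<in> cells d v - cells d m \<Longrightarrow> j = v i"
    "(i, j) \<in> cells d v - cells d m \<Longrightarrow> (Suc i, j) \<notin> cells d v"
proof -
  have v: "m i \<le> v i" "v i \<le> Suc (m i)" "1 < i \<Longrightarrow> v i \<le> m (i - 1)" "v i \<le> l i" if "i \<in> {1..d}" for i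
    using assms that by (auto simp: rook_steps_def rook_extensions_def PiE_iff)
  show "cells d m \<subseteq> cells d v" "cells d v \<subseteq> cells d l" using v by (fastforce simp: cells_def)+
  show "(i, j) \<in> cells d v - cells d m \<Longrightarrow> j = v i" using v[of i] by auto
  show "(i, j) \<in> cells d v - cells d m \<Longrightarrow> (Suc i, j) \<notin> cells d v" using v(3)[of "Suc i"] by auto
  have "\<exists>i\<in>{1..d}. v i \<noteq> m i"
  proof (rule ccontr)
    assume "\<not> ?thesis"
    then have "v = restrict m {1..d}"
      using assms by (auto simp: rook_steps_def rook_extensions_def PiE_iff extensional_def fun_eq_iff)
    then show False using assms by (simp add: rook_steps_def)
  qed
  then obtain i where i: "i \<in> {1..d}" "v i \<noteq> m i" by blast
  then have "m i < v i" using v(1)[of i] by simp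
  then have "(i, v i) \<in> cells d v - cells d m" using i by auto
  then show "\<exists>c. c \<in> cells d v - cells d m" by blast
qed

text \<open>Truncated subtraction sends the entries 1 to 0, the default value outside the smaller
  skew shape, so the decremented function is directly a filling of it.\<close>

lemma decrement_filling:
  assumes T: "T \<in> incr_fillings (cells d l - cells d m)" and ne: "cells d l - cells d m \<noteq> {}"
  defines "v \<equiv> filled_shape d l m T 2"
  shows "(\<lambda>c. T c - 1) \<in> incr_fillings (cells d l - cells d v)"
    and "card (T ` (cells d l - cells d m)) = Suc (card ((\<lambda>c. T c - 1) ` (cells d l - cells d v)))"
proof -
  let ?K = "cells d l - cells d m" and ?N = "cells d l - cells d v"
  have iff: "c \<in> cells d v \<longleftrightarrow> c \<in> cells d m \<or> c \<in> ?K \<and> T c = 1" for c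
    unfolding v_def using filled_shape_2_cells[OF T] by (cases c) blast
  have sub: "?N \<subseteq> ?K" using iff by blast
  have ge2: "2 \<le> T c" if "c \<in> ?N" for c
  proof -
    have "c \<in> ?K" "T c \<noteq> 1" using that iff by blast+
    then show ?thesis using incr_fillingsD(5)[OF T, of c] by simp
  qed
  define n where "n = card (T ` ?K)"
  have im: "T ` ?K = {1..n}" unfolding n_def by (rule incr_fillingsD(4)[OF T])
  have n: "1 \<le> n" using im ne by (metis atLeastatMost_empty_iff2 image_is_empty)
  have "T ` ?N = {2..n}"
  proof (intro equalityI subsetI)
    fix x assume "x \<in> T ` ?N"
    then obtain c where c: "c \<in> ?N" "x = T c" by blast
    then have "x \<in> {1..n}" using im sub by blast
    then show "x \<in> {2..n}" using ge2[OF c(1)] c(2) by simp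
  next
    fix x assume x: "x \<in> {2..n}"
    then have "x \<in> T ` ?K" unfolding im by simp
    then obtain c where c: "c \<in> ?K" "x = T c" by blast
    then have "c \<notin> cells d v" using iff x by auto
    then show "x \<in> T ` ?N" using c by blast
  qed
  then have im': "(\<lambda>c. T c - 1) ` ?N = {1..n - 1}"
  proof -
    have "(\<lambda>c. T c - 1) ` ?N = (\<lambda>x. x - 1) ` T ` ?N" by (simp add: image_image)
    also have "\<dots> = (\<lambda>x. x - 1) ` {2..n}" using \<open>T ` ?N = {2..n}\<close> by simp
    also have "\<dots> = {1..n - 1}"
    proof (intro equalityI subsetI)
      fix x assume "x \<in> {1..n - 1}"
      then have "x = Suc x - 1" "Suc x \<in> {2..n}" by auto
      then show "x \<in> (\<lambda>x. x - 1) ` {2..n}" by blast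
    qed auto
    finally show ?thesis .
  qed
  show "card (T ` ?K) = Suc (card ((\<lambda>c. T c - 1) ` ?N))"
    unfolding im im' using n by simp
  show "(\<lambda>c. T c - 1) \<in> incr_fillings ?N"
    unfolding incr_fillings_def
  proof (intro CollectI conjI allI impI)
    fix c assume "c \<notin> ?N"
    then have "c \<notin> ?K \<or> T c = 1" using iff by blast
    then show "T c - 1 = 0"
    proof
      assume "c \<notin> ?K"
      then show ?thesis using incr_fillingsD(1)[OF T] by simp
    qed simp
  next
    fix i j assume c: "(i, j) \<in> ?N \<and> (i, Suc j) \<in> ?N"
    then have "T (i, j) < T (i, Suc j)" using incr_fillingsD(2)[OF T] sub by blast
    then show "T (i, j) - 1 < T (i, Suc j) - 1" using ge2[of "(i, j)"] c by simp
  next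
    fix i j assume c: "(i, j) \<in> ?N \<and> (Suc i, j) \<in> ?N"
    then have "T (i, j) < T (Suc i, j)" using incr_fillingsD(3)[OF T] sub by blast
    then show "T (i, j) - 1 < T (Suc i, j) - 1" using ge2[of "(i, j)"] c by simp
  qed (use im' in blast)
qed

text \<open>Inverse to decrementing: the cells of \<open>v / m\<close> carry the default value 0 of
  \<open>T\<close> and thereby receive the entry 1.\<close>

definition increment :: "(nat \<times> nat \<Rightarrow> nat) \<Rightarrow> nat \<times> nat \<Rightarrow> nat" where
  "increment T c = (if c \<in> cells d l - cells d m then Suc (T c) else 0)"

lemma increment_filling:
  assumes v: "v \<in> rook_steps d l m" and T: "T \<in> incr_fillings (cells d l - cells d v)"
  shows "increment T \<in> incr_fillings (cells d l - cells d m)"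
    and "filled_shape d l m (increment T) 2 = v"
    and "(\<lambda>c. increment T c - 1) = T"
proof -
  let ?K = "cells d l - cells d m" and ?N = "cells d l - cells d v"
  note c = rook_steps_cells[OF v]
  have vE: "v \<in> rook_extensions d m" using v by (simp add: rook_steps_def)
  have dv: "dec d v" by (rule rook_extensions_dec[OF vE])
  have T0: "T c = 0 \<longleftrightarrow> c \<notin> ?N" for c
    using incr_fillingsD(1,5)[OF T, of c] by fastforce
  show "(\<lambda>c. increment T c - 1) = T"
  proof
    fix x show "increment T x - 1 = T x" using T0[of x] c(1) by (auto simp: increment_def)
  qed
  show inc: "increment T \<in> incr_fillings ?K"
    unfolding incr_fillings_def
  proof (intro CollectI conjI allI impI)
    fix x assume "x \<notin> ?K" then show "increment T x = 0" by (auto simp: increment_def)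
  next
    fix i j assume K: "(i, j) \<in> ?K \<and> (i, Suc j) \<in> ?K"
    have "T (i, j) < T (i, Suc j)"
    proof (cases "(i, j) \<in> cells d v")
      case True
      then have "j = v i" using K c(4) by blast
      then have "(i, Suc j) \<in> ?N" using K by auto
      then show ?thesis using True T0[of "(i, j)"] incr_fillingsD(5)[OF T] by fastforce
    next
      case False
      then have "(i, j) \<in> ?N \<and> (i, Suc j) \<in> ?N" using K by auto
      then show ?thesis using incr_fillingsD(2)[OF T] by blast
    qed
    then show "increment T (i, j) < increment T (i, Suc j)" using K by (simp add: increment_def)
  next
    fix i j assume K: "(i, j) \<in> ?K \<and> (Suc i, j) \<in> ?K"
    have "T (i, j) < T (Suc i, j)"
    proof (cases "(i, j) \<in> cells d v")
      case True
      then have "(Suc i, j) \<in> ?N" using K c(5) by blast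
      then show ?thesis using True T0[of "(i, j)"] incr_fillingsD(5)[OF T] by fastforce
    next
      case False
      then have "(i, j) \<in> ?N \<and> (Suc i, j) \<in> ?N" using K decD[OF dv, of i] by auto
      then show ?thesis using incr_fillingsD(3)[OF T] by blast
    qed
    then show "increment T (i, j) < increment T (Suc i, j)" using K by (simp add: increment_def)
  next
    define n where "n = card (T ` ?N)"
    have im: "T ` ?N = {1..n}" unfolding n_def by (rule incr_fillingsD(4)[OF T])
    have "?K = ?N \<union> (cells d v - cells d m)" using c(1,2) by blast
    then have "T ` ?K = {1..n} \<union> T ` (cells d v - cells d m)" using im by blast
    also have "T ` (cells d v - cells d m) = {0}"
    proof -
      have "T ` (cells d v - cells d m) = (\<lambda>_. 0) ` (cells d v - cells d m)"
        using T0 by (intro image_cong) blast+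
      moreover have "cells d v - cells d m \<noteq> {}" using c(3) by blast
      ultimately show ?thesis unfolding image_constant_conv by (simp only: if_False)
    qed
    also have "{1..n} \<union> {0} = {0..n}" by auto
    finally have "Suc ` T ` ?K = {1..Suc n}" by (simp only: image_Suc_atLeastAtMost) simp
    moreover have "increment T ` ?K = Suc ` T ` ?K"
      unfolding image_image by (rule image_cong) (auto simp: increment_def)
    ultimately show "\<exists>n. increment T ` ?K = {1..n}" by blast
  qed
  show "filled_shape d l m (increment T) 2 = v"
  proof
    fix i
    show "filled_shape d l m (increment T) 2 i = v i"
    proof (cases "i \<in> {1..d}")
      case True
      have "(i, j) \<in> cells d (filled_shape d l m (increment T) 2) \<longleftrightarrow> (i, j) \<in> cells d v" for j
      proof -
        have "(i, j) \<in> ?K \<Longrightarrow> increment T (i, j) = 1 \<longleftrightarrow> (i, j) \<notin> ?N"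
          using T0[of "(i, j)"] by (simp add: increment_def del: Diff_iff)
        then show ?thesis unfolding filled_shape_2_cells[OF inc] using c(1,2) by blast
      qed
      then have "j \<in> {1..filled_shape d l m (increment T) 2 i} \<longleftrightarrow> j \<in> {1..v i}" for j
        using True by simp
      then have "{1..filled_shape d l m (increment T) 2 i} = {1..v i}" by blast
      then show ?thesis by (metis card_atLeastAtMost diff_Suc_1)
    next
      case False
      then have "v i = undefined"
        using vE unfolding rook_extensions_def PiE_iff extensional_def by blast
      then show ?thesis using False unfolding filled_shape_def restrict_def by (simp only: if_False)
    qed
  qed
qed

lemma filled_shape_Suc:
  assumes T: "T \<in> incr_fillings (cells d l - cells d m)" and k: "1 \<le> k"
  shows "filled_shape d l m T (Suc k) = filled_shape d l (filled_shape d l m T 2) (\<lambda>c. T c - 1) k"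
proof
  fix i
  let ?v = "filled_shape d l m T 2"
  have "(i, j) \<in> cells d m \<or> (i, j) \<in> cells d l - cells d m \<and> T (i, j) < Suc k \<longleftrightarrow>
      (i, j) \<in> cells d ?v \<or> (i, j) \<in> cells d l - cells d ?v \<and> T (i, j) - 1 < k" for j
    unfolding Diff_iff filled_shape_2_cells[OF T] using k incr_fillingsD(5)[OF T, of "(i, j)"] by auto
  then show "filled_shape d l m T (Suc k) i = filled_shape d l ?v (\<lambda>c. T c - 1) k i"
    unfolding filled_shape_def[of d l m T "Suc k"] filled_shape_def[of d l ?v] by (simp only: restrict_apply)
qed

text \<open>The factor for k = 1 sees the shape \<open>m\<close> itself, and decrementing shifts the
  index of the remaining factors by one. A nonempty skew shape guarantees that this factor
  occurs.\<close>

lemma filling_sum_rec: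
  assumes ne: "cells d l - cells d m \<noteq> {}"
  shows "filling_sum w d l m = w (restrict m {1..d}) * (\<Sum>v\<in>rook_steps d l m. filling_sum w d l v)"
proof -
  let ?K = "\<lambda>v. cells d l - cells d v"
  let ?P = "\<lambda>v T. \<Prod>k=1..card (T ` ?K v). w (filled_shape d l v T k)"
  have fin: "finite (rook_steps d l m)" by (simp add: rook_steps_def)
  have fin': "finite (incr_fillings (?K v))" for v by (intro finite_incr_fillings) simp
  have "filling_sum w d l m = (\<Sum>(v, T)\<in>(SIGMA v:rook_steps d l m. incr_fillings (?K v)).
      w (restrict m {1..d}) * ?P v T)"
    unfolding filling_sum_def
  proof (rule sum.reindex_bij_witness[where j = "\<lambda>T. (filled_shape d l m T 2, \<lambda>c. T c - 1)"
        and i = "\<lambda>(v, T). increment T"])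
    fix T assume T: "T \<in> incr_fillings (?K m)"
    show "(case (filled_shape d l m T 2, \<lambda>c. T c - 1) of (v, T) \<Rightarrow> increment T) = T"
    proof
      fix c show "(case (filled_shape d l m T 2, \<lambda>c. T c - 1) of (v, T) \<Rightarrow> increment T) c = T c"
        using incr_fillingsD(1,5)[OF T, of c] by (cases "c \<in> ?K m") (auto simp: increment_def)
    qed
    show "(filled_shape d l m T 2, \<lambda>c. T c - 1) \<in> (SIGMA v:rook_steps d l m. incr_fillings (?K v))"
      using filled_shape_2_rook[OF T ne] decrement_filling(1)[OF T ne] by simp
    have "?P m T = w (filled_shape d l m T 1)
      * (\<Prod>k=1..card ((\<lambda>c. T c - 1) ` ?K (filled_shape d l m T 2)). w (filled_shape d l m T (Suc k)))"
      unfolding decrement_filling(2)[OF T ne]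
      by (subst prod.atLeast_Suc_atMost, simp) (simp only: prod.shift_bounds_cl_Suc_ivl One_nat_def)
    also have "\<dots> = w (restrict m {1..d}) * ?P (filled_shape d l m T 2) (\<lambda>c. T c - 1)"
      unfolding filled_shape_1[OF T] using filled_shape_Suc[OF T]
      by (intro arg_cong2[where f = "(*)"] prod.cong refl) auto
    finally show "(case (filled_shape d l m T 2, \<lambda>c. T c - 1) of
        (v, T) \<Rightarrow> w (restrict m {1..d}) * ?P v T) = ?P m T" by (simp only: case_prod_conv)
  next
    fix b assume "b \<in> (SIGMA v:rook_steps d l m. incr_fillings (?K v))"
    then obtain v T where b: "b = (v, T)" "v \<in> rook_steps d l m" "T \<in> incr_fillings (?K v)" by blast
    note i = increment_filling[OF b(2,3)]
    show "(case b of (v, T) \<Rightarrow> increment T) \<in> incr_fillings (?K m)" using i(1) b(1) by simp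
    show "(filled_shape d l m (case b of (v, T) \<Rightarrow> increment T) 2,
        \<lambda>c. (case b of (v, T) \<Rightarrow> increment T) c - 1) = b"
      using i(2,3) b(1) by (simp only: case_prod_conv)
  qed
  also have "\<dots> = w (restrict m {1..d}) * (\<Sum>v\<in>rook_steps d l m. filling_sum w d l v)"
    unfolding filling_sum_def sum_distrib_left using fin fin' by (subst sum.Sigma[symmetric]) auto
  finally show ?thesis .
qed

end

lemma filling_sum_full:
  assumes "cells d l - cells d m = {}"
  shows "filling_sum w d l m = 1"
proof -
  have "incr_fillings {} = {\<lambda>_. 0}" by (auto simp: incr_fillings_def)
  then show ?thesis unfolding filling_sum_def assms by simp
qed

subsection \<open>The hook formula\<close>

lemma prod_dual_point:
  "(\<Prod>i=1..d. dual_point A d l i) = (\<Prod>i=1..d. 1 / A (int (l i) + int d - int i + 1))"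
proof (rule prod.reindex_bij_witness[where i = "\<lambda>i. d + 1 - i" and j = "\<lambda>i. d + 1 - i"])
  fix i assume i: "i \<in> {1..d}"
  then have "int (l (d + 1 - i)) + int d - int (d + 1 - i) + 1 = int (l (d + 1 - i)) + int i" by simp
  then show "1 / A (int (l (d + 1 - i)) + int d - int (d + 1 - i) + 1) = dual_point A d l i"
    by (simp only: dual_point_def)
qed auto

text \<open>At the dual point the Pieri factor is \<open>R m\<close>. Moving the summand
  \<open>m\<close> to the left leaves \<open>R m - 1\<close> times the value at \<open>m\<close> as
  a sum over \<open>rook_steps\<close>, the recursion of \<open>filling_sum\<close>. The
  multiplicative form holds without knowing that the value at \<open>l\<close> is nonzero.\<close>

lemma filling_sum_eq_groth:
  fixes A :: "int \<Rightarrow> 'a::field"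
  assumes A: "\<And>k. A k \<noteq> 0" and l: "dec d l"
  defines "R \<equiv> \<lambda>v. \<Prod>i=1..d. A (int (v i) + int d - int i + 1) / A (int (l i) + int d - int i + 1)"
  assumes R: "\<And>v. (\<And>i. i \<in> {1..d} \<Longrightarrow> v i \<le> l i) \<Longrightarrow> (\<exists>i\<in>{1..d}. v i \<noteq> l i) \<Longrightarrow> R v \<noteq> 1"
  shows "dec d m \<Longrightarrow> (\<And>i. i \<in> {1..d} \<Longrightarrow> m i \<le> l i) \<Longrightarrow>
    filling_sum (\<lambda>v. inverse (R v - 1)) d l m * groth (dual_point A d l) A d l
      = groth (dual_point A d l) A d m"
proof (induction "card (cells d l - cells d m)" arbitrary: m rule: less_induct)
  case less
  note m = less.prems(1) and le = less.prems(2)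
  let ?X = "dual_point A d l"
  let ?F = "filling_sum (\<lambda>v. inverse (R v - 1)) d l"
  show ?case
  proof (cases "cells d l - cells d m = {}")
    case True
    have "l i = m i" if i: "i \<in> {1..d}" for i
    proof (rule ccontr)
      assume "l i \<noteq> m i"
      then have "(i, l i) \<in> cells d l - cells d m" using le[OF i] i by auto
      then show False using True by blast
    qed
    then have "groth ?X A d l = groth ?X A d m" by (rule groth_cong_shape)
    then show ?thesis by (simp add: filling_sum_full[OF True])
  next
    case False
    then obtain c where "c \<in> cells d l - cells d m" by blast
    moreover obtain i j where "c = (i, j)" by (cases c)
    ultimately have "i \<in> {1..d}" "m i \<noteq> l i" by auto
    then have "\<exists>i\<in>{1..d}. m i \<noteq> l i" by blast
    from R[OF le this] have R1: "R m - 1 \<noteq> 0" by simp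
    let ?m = "restrict m {1..d}"
    have mE: "?m \<in> rook_extensions d m"
    proof -
      have "m i \<le> m (i - 1)" if "i \<in> {1..d}" "1 < i" for i
        using decD[OF m, of "i - 1"] that by simp
      then show ?thesis by (auto simp: rook_extensions_def)
    qed
    have van: "groth ?X A d v = 0" if "v \<in> rook_extensions d m" "\<not> (\<forall>i\<in>{1..d}. v i \<le> l i)" for v
      using groth_vanishing[where A = A and l = l and m = v, OF A l rook_extensions_dec[OF that(1)]] that(2)
      by blast
    have "groth ?X A d m * R m = groth ?X A d m * (\<Prod>i=1..d. ?X i * A (int (m i) + int d - int i + 1))"
      unfolding R_def prod.distrib prod_dual_point prod_dividef by simp
    also have "\<dots> = (\<Sum>v\<in>rook_extensions d m. groth ?X A d v)"
      by (rule groth_pieri[where A = A, OF A m])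
    also have "\<dots> = groth ?X A d ?m + (\<Sum>v\<in>rook_extensions d m - {?m}. groth ?X A d v)"
      by (rule sum.remove[OF finite_rook_extensions mE])
    also have "(\<Sum>v\<in>rook_extensions d m - {?m}. groth ?X A d v) = (\<Sum>v\<in>rook_steps d l m. groth ?X A d v)"
      using van by (intro sum.mono_neutral_right) (auto simp: rook_steps_def)
    also have "groth ?X A d ?m = groth ?X A d m" by (rule groth_cong_shape) simp
    finally have rec: "groth ?X A d m * (R m - 1) = (\<Sum>v\<in>rook_steps d l m. groth ?X A d v)"
      by (simp add: right_diff_distrib)
    have "?F m = inverse (R ?m - 1) * (\<Sum>v\<in>rook_steps d l m. ?F v)"
      by (rule filling_sum_rec[OF l m le False])
    then have "?F m * groth ?X A d l
      = inverse (R ?m - 1) * (\<Sum>v\<in>rook_steps d l m. ?F v * groth ?X A d l)"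
      by (simp only: sum_distrib_right mult.assoc)
    also have "R ?m = R m" by (auto simp: R_def intro: prod.cong)
    also have "(\<Sum>v\<in>rook_steps d l m. ?F v * groth ?X A d l) = (\<Sum>v\<in>rook_steps d l m. groth ?X A d v)"
    proof (rule sum.cong[OF refl])
      fix v assume v: "v \<in> rook_steps d l m"
      have "cells d l - cells d v \<subset> cells d l - cells d m"
        using rook_steps_cells(1,2,3)[OF l m le v] by blast
      then have "card (cells d l - cells d v) < card (cells d l - cells d m)"
        by (intro psubset_card_mono) auto
      then show "?F v * groth ?X A d l = groth ?X A d v"
        using v by (intro less.hyps) (auto simp: rook_steps_def intro: rook_extensions_dec)
    qed
    also have "\<dots> = groth ?X A d m * (R m - 1)" by (rule rec[symmetric])
    finally show ?thesis using R1 by simp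
  qed
qed

section \<open>The specialisation a_k = k over the rational functions in beta\<close>

abbreviation affine :: "int \<Rightarrow> rat poly fract" where
  "affine k \<equiv> 1 + beta * of_int k"

text \<open>Polynomials are ordered by the sign of the leading coefficient, and the fraction field
  inherits this order. It serves to show that the ratios to be inverted are not 1.\<close>

lemma beta_pos: "beta > 0"
proof -
  have "0 < [:0, 1 :: rat:]" by (simp add: less_poly_def pos_poly_pCons)
  then show ?thesis unfolding beta_def by (subst zero_less_Fract_iff) simp_all
qed

lemma of_int_fract: "(of_int k :: rat poly fract) = Fract (of_int k) 1"
  by (cases k) (simp_all add: of_nat_fract One_fract_def)

text \<open>The constant coefficient is 1, so negative \<open>k\<close> are covered too, as the
  assumption on \<open>A\<close> in the general results demands.\<close>

lemma affine_nonzero: "affine k \<noteq> 0"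
proof -
  have "affine k = Fract [:1, of_int k:] 1"
    by (simp add: beta_def of_int_fract One_fract_def of_int_poly one_pCons)
  also have "\<dots> \<noteq> 0" by (simp add: Zero_fract_def eq_fract)
  finally show ?thesis .
qed

lemma affine_pos: "0 \<le> k \<Longrightarrow> affine k > 0"
  using beta_pos by (intro add_pos_nonneg mult_nonneg_nonneg) auto

text \<open>Every factor lies between 0 and 1, and a row with \<open>v i < l i\<close> gives a
  factor strictly below 1.\<close>

lemma affine_prod_ratio_neq_1:
  fixes l v :: "nat \<Rightarrow> nat"
  assumes le: "\<And>i. i \<in> {1..d} \<Longrightarrow> v i \<le> l i" and ne: "\<exists>i\<in>{1..d}. v i \<noteq> l i"
  shows "(\<Prod>i=1..d. affine (int (v i) + int d - int i + 1) / affine (int (l i) + int d - int i + 1)) \<noteq> 1"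
proof -
  let ?f = "\<lambda>i. affine (int (v i) + int d - int i + 1) / affine (int (l i) + int d - int i + 1)"
  have f0: "0 \<le> ?f i" and f1: "?f i \<le> 1" if "i \<in> {1..d}" for i
  proof -
    have "0 < affine (int (l i) + int d - int i + 1)" "0 < affine (int (v i) + int d - int i + 1)"
      using that by (intro affine_pos, simp)+
    moreover have "affine (int (v i) + int d - int i + 1) \<le> affine (int (l i) + int d - int i + 1)"
      using beta_pos le[OF that] by (intro add_left_mono mult_left_mono) auto
    ultimately show "0 \<le> ?f i" "?f i \<le> 1" by simp_all
  qed
  obtain h where h: "h \<in> {1..d}" "v h \<noteq> l h" using ne by blast
  have "0 < affine (int (l h) + int d - int h + 1)"
    using h by (intro affine_pos) simp
  moreover have "affine (int (v h) + int d - int h + 1) < affine (int (l h) + int d - int h + 1)"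
    using beta_pos le[OF h(1)] h(2) by (intro add_strict_left_mono mult_strict_left_mono) auto
  ultimately have fh: "?f h < 1" by simp
  have "(\<Prod>i=1..d. ?f i) = ?f h * (\<Prod>i\<in>{1..d} - {h}. ?f i)"
    by (rule prod.remove) (use h in auto)
  also have "\<dots> \<le> ?f h * 1"
    using f0 f1 h(1) by (intro mult_left_mono prod_le_1) blast+
  also have "\<dots> < 1" using fh by simp
  finally show ?thesis by simp
qed

section \<open>Translation from partitions given as lists\<close>

lemma diagram_eq_cells:
  assumes "length lam \<le> d"
  shows "diagram lam = cells d (part lam)"
  using assms by (auto simp: diagram_def part_def split: if_splits)

lemma dec_part:
  assumes "is_partition lam"
  shows "dec d (part lam)"
  using assms by (auto simp: dec_def is_partition_def part_def sorted_wrt_iff_nth_less)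

lemma length_le_of_diagram_subset:
  assumes "is_partition mu" "diagram mu \<subseteq> diagram lam"
  shows "length mu \<le> length lam"
proof (cases "mu = []")
  case False
  then have "mu ! (length mu - 1) \<in> set mu" by simp
  then have "mu ! (length mu - 1) \<noteq> 0" using assms(1) unfolding is_partition_def by metis
  then have "0 < part mu (length mu)" using False by (simp add: part_def Suc_le_eq)
  then have "(length mu, 1) \<in> diagram mu" using False by (auto simp: diagram_def Suc_le_eq)
  then have "(length mu, 1) \<in> diagram lam" using assms(2) by blast
  then show ?thesis by (auto simp: diagram_def part_def split: if_splits)
qed simp

lemma SIT_eq: "SIT lam mu = incr_fillings (diagram lam - diagram mu)"
  by (simp only: SIT_def incr_fillings_def)

lemma SSVT_eq:
  assumes "length mu \<le> d"
  shows "SSVT d mu = svt d (part mu)"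
proof (intro equalityI subsetI)
  note eq = diagram_eq_cells[OF assms]
  fix S
  {
    assume "S \<in> SSVT d mu"
    then have S: "\<And>c. c \<notin> cells d (part mu) \<Longrightarrow> S c = {}"
      "\<And>c. c \<in> cells d (part mu) \<Longrightarrow> S c \<noteq> {} \<and> S c \<subseteq> {1..d}"
      "\<And>i j. (i, j) \<in> cells d (part mu) \<Longrightarrow> (i, Suc j) \<in> cells d (part mu) \<Longrightarrow> Max (S (i, j)) \<le> Min (S (i, Suc j))"
      "\<And>i j. (i, j) \<in> cells d (part mu) \<Longrightarrow> (Suc i, j) \<in> cells d (part mu) \<Longrightarrow> Max (S (i, j)) < Min (S (Suc i, j))"
      unfolding SSVT_def eq by blast+
    have fin: "finite (S c)" for c
      using S(1,2)[of c] finite_subset[of "S c" "{1..d}"] by fastforce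
    have cell: "c \<in> cells d (part mu)" if "a \<in> S c" for a c using S(1)[of c] that by blast
    show "S \<in> svt d (part mu)"
      unfolding svt_def
    proof (intro CollectI conjI allI impI)
      fix c show "S c \<subseteq> {1..d}" using S(1,2)[of c] by blast
      show "S c \<noteq> {} \<longleftrightarrow> c \<in> cells d (part mu)" using S(1,2)[of c] by blast
    next
      fix i j a b assume a: "a \<in> S (i, j)" and b: "b \<in> S (i, Suc j)"
      have "a \<le> Max (S (i, j))" "Min (S (i, Suc j)) \<le> b" using fin a b by auto
      then show "a \<le> b" using S(3)[OF cell[OF a] cell[OF b]] by simp
    next
      fix i j a b assume a: "a \<in> S (i, j)" and b: "b \<in> S (Suc i, j)"
      have "a \<le> Max (S (i, j))" "Min (S (Suc i, j)) \<le> b" using fin a b by auto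
      then show "a < b" using S(4)[OF cell[OF a] cell[OF b]] by simp
    qed
  next
    assume S: "S \<in> svt d (part mu)"
    have sub: "S c \<subseteq> {1..d}" for c using S unfolding svt_def by blast
    then have fin: "finite (S c)" for c by (rule finite_subset) simp
    have mm: "Max (S c) \<in> S c" "Min (S c) \<in> S c" if "c \<in> cells d (part mu)" for c
      using svtD(3)[OF S, of c] that fin by auto
    show "S \<in> SSVT d mu"
      unfolding SSVT_def eq
    proof (intro CollectI conjI allI impI ballI)
      fix c show "c \<notin> cells d (part mu) \<Longrightarrow> S c = {}" "c \<in> cells d (part mu) \<Longrightarrow> S c \<noteq> {}"
        using svtD(3)[OF S, of c] by blast+
      show "S c \<subseteq> {1..d}" by (rule sub)
    next
      fix i j assume "(i, j) \<in> cells d (part mu) \<and> (i, Suc j) \<in> cells d (part mu)"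
      then show "Max (S (i, j)) \<le> Min (S (i, Suc j))" using mm svtD(4)[OF S] by blast
    next
      fix i j assume "(i, j) \<in> cells d (part mu) \<and> (Suc i, j) \<in> cells d (part mu)"
      then show "Max (S (i, j)) < Min (S (Suc i, j))" using mm svtD(5)[OF S] by blast
    qed
  }
qed

lemma nu_part_eq:
  assumes "length lam \<le> d" "length mu \<le> d" "i \<in> {1..d}"
  shows "nu_part lam mu T k i = filled_shape d (part lam) (part mu) T k i"
  using assms(3) by (simp only: nu_part_def filled_shape_def restrict_apply if_True
      diagram_eq_cells[OF assms(1)] diagram_eq_cells[OF assms(2)])

text \<open>The two indices of \<open>A\<close> differ by minus the hook length, \<open>(d + j -
  \<lambda>'_j) - (\<lambda>_i + d - i + 1) = - h(i, j)\<close>. Each cell contributes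
  \<open>- \<beta> h(i, j)\<close> over a denominator that depends on the row alone.\<close>

lemma groth_diagonal_hook:
  assumes lam: "is_partition lam" "length lam \<le> d"
  shows "groth (dual_point affine d (part lam)) affine d (part lam)
    = (- beta) ^ size_part lam * (\<Prod>c\<in>diagram lam. of_int (hook lam c))
      / (\<Prod>i=1..d. affine (int (part lam i) + int d - int i + 1) ^ part lam i)"
proof -
  let ?l = "part lam"
  have conj: "conj_part lam j = col_length d ?l j" if "1 \<le> j" for j
  proof -
    have "{i. 1 \<le> i \<and> j \<le> ?l i} = {i\<in>{1..d}. j \<le> ?l i}"
      using that lam(2) by (auto simp: part_def split: if_splits)
    then show ?thesis by (simp only: conj_part_def col_length_def)
  qed
  have "groth (dual_point affine d ?l) affine d ?l
    = (\<Prod>i=1..d. \<Prod>j=1..?l i. (- beta) * of_int (hook lam (i, j)) / affine (int (?l i) + int d - int i + 1))"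
    unfolding groth_diagonal[where A = affine, OF affine_nonzero dec_part[OF lam(1)]]
  proof (intro prod.cong refl)
    fix i j assume ij: "i \<in> {1..d}" "j \<in> {1..?l i}"
    have "hook lam (i, j) = int (?l i) - int j + int (col_length d ?l j) - int i + 1"
      using conj[of j] ij by (simp add: hook_def)
    then have "(int d + int j - int (col_length d ?l j)) - (int (?l i) + int d - int i + 1) = - hook lam (i, j)"
      by simp
    moreover have "affine x / affine y - 1 = beta * of_int (x - y) / affine y" for x y
      using affine_nonzero[of y] by (simp add: divide_simps) (simp add: algebra_simps)
    ultimately show "affine (int d + int j - int (col_length d ?l j)) / affine (int (?l i) + int d - int i + 1) - 1
      = (- beta) * of_int (hook lam (i, j)) / affine (int (?l i) + int d - int i + 1)"
      by (simp only: of_int_minus mult_minus_left mult_minus_right)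
  qed
  also have "\<dots> = (\<Prod>i=1..d. \<Prod>j=1..?l i. (- beta) * of_int (hook lam (i, j)))
      / (\<Prod>i=1..d. affine (int (?l i) + int d - int i + 1) ^ ?l i)"
    by (simp only: prod_dividef prod_constant card_atLeastAtMost diff_Suc_1)
  also have "(\<Prod>i=1..d. \<Prod>j=1..?l i. (- beta) * of_int (hook lam (i, j)))
      = (\<Prod>c\<in>diagram lam. (- beta) * of_int (hook lam c))"
    unfolding diagram_eq_cells[OF lam(2)] cells_def by (subst prod.Sigma) auto
  also have "\<dots> = (- beta) ^ size_part lam * (\<Prod>c\<in>diagram lam. of_int (hook lam c))"
    by (simp only: prod.distrib prod_constant size_part_def)
  finally show ?thesis .
qed

text \<open>Rows 1 to i all reach column j, so the column length is at least i.\<close>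

lemma hook_pos:
  assumes lam: "is_partition lam" and c: "c \<in> diagram lam"
  shows "0 < hook lam c"
proof -
  obtain i j where ij: "c = (i, j)" "1 \<le> i" "1 \<le> j" "j \<le> part lam i" using c by (auto simp: diagram_def)
  have len: "i \<le> length lam" using ij by (auto simp: part_def split: if_splits)
  have "{1..i} \<subseteq> {i. 1 \<le> i \<and> j \<le> part lam i}"
    using dec_le[OF dec_part[OF lam, of "length lam"], of _ i] ij len by fastforce
  moreover have "finite {i. 1 \<le> i \<and> j \<le> part lam i}"
  proof (rule finite_subset)
    show "{i. 1 \<le> i \<and> j \<le> part lam i} \<subseteq> {..length lam}"
      using ij(3) by (auto simp: part_def split: if_splits)
  qed simp
  ultimately have "card {1..i} \<le> conj_part lam j" unfolding conj_part_def by (rule card_mono[rotated])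
  then show ?thesis using ij by (simp add: hook_def)
qed

text \<open>For the entry r in cell (i, j) the indices differ by \<open>(r + j - i) - (l (d + 1 - r)
  + r) = - (l (d + 1 - r) + i - j)\<close>; each entry therefore contributes one factor
  \<open>- \<beta>\<close>.\<close>

lemma groth_dual_point_sum:
  assumes mu: "length mu \<le> d"
  shows "groth (dual_point affine d l) affine d (part mu)
    = (\<Sum>S\<in>SSVT d mu. (- beta) ^ num_entries mu S
        * (\<Prod>(i, j)\<in>diagram mu. \<Prod>r\<in>S (i, j).
            (of_nat (l (d + 1 - r)) + of_nat i - of_nat j) / (1 + beta * (of_nat (l (d + 1 - r)) + of_nat r))))"
  unfolding groth_def SSVT_eq[OF mu] diagram_eq_cells[OF mu] num_entries_def
proof (rule sum.cong[OF refl])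
  fix S
  let ?q = "\<lambda>c r. (of_nat (l (d + 1 - r)) + of_nat (fst c) - of_nat (snd c))
    / (1 + beta * (of_nat (l (d + 1 - r)) + of_nat r))"
  have "cell_weight (dual_point affine d l) affine r c = (- beta) * ?q c r" for r c
  proof -
    define a where "a = l (d + 1 - r)"
    have nz: "1 + beta * (of_nat a + of_nat r) \<noteq> 0"
      using affine_nonzero[of "int a + int r"] by simp
    have "cell_weight (dual_point affine d l) affine r c
      = (1 + beta * (of_nat r + of_nat (snd c) - of_nat (fst c))) / (1 + beta * (of_nat a + of_nat r)) - 1"
      by (simp add: cell_weight_def dual_point_def a_def)
    also have "\<dots> = (- beta) * (of_nat a + of_nat (fst c) - of_nat (snd c)) / (1 + beta * (of_nat a + of_nat r))"
      using nz by (simp add: divide_simps) (simp add: algebra_simps)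
    finally show ?thesis by (simp add: a_def)
  qed
  then have "(\<Prod>c\<in>cells d (part mu). \<Prod>r\<in>S c. cell_weight (dual_point affine d l) affine r c)
    = (\<Prod>c\<in>cells d (part mu). (- beta) ^ card (S c) * (\<Prod>r\<in>S c. ?q c r))"
    by (simp only: prod.distrib prod_constant)
  also have "\<dots> = (- beta) ^ (\<Sum>c\<in>cells d (part mu). card (S c)) * (\<Prod>c\<in>cells d (part mu). \<Prod>r\<in>S c. ?q c r)"
    by (simp only: prod.distrib power_sum)
  finally show "(\<Prod>c\<in>cells d (part mu). \<Prod>r\<in>S c. cell_weight (dual_point affine d l) affine r c)
    = (- beta) ^ (\<Sum>c\<in>cells d (part mu). card (S c)) * (\<Prod>(i, j)\<in>cells d (part mu). \<Prod>r\<in>S (i, j).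
            (of_nat (l (d + 1 - r)) + of_nat i - of_nat j) / (1 + beta * (of_nat (l (d + 1 - r)) + of_nat r)))"
    by (simp only: case_prod_unfold prod.collapse)
qed

theorem theorem6p8:
  fixes d :: nat and lam mu :: "nat list"
  assumes "d \<ge> 1"
    and "is_partition lam" and "is_partition mu"
    and "diagram mu \<subseteq> diagram lam"
    and "length lam \<le> d"
  shows "(\<Sum>T \<in> SIT lam mu. \<Prod>k = 1..sit_max lam mu T.
            inverse ((\<Prod>i = 1..d.
               (1 + beta * (of_nat (nu_part lam mu T k i) + of_nat d - of_nat i + 1))
               / (1 + beta * (of_nat (part lam i) + of_nat d - of_nat i + 1))) - 1))
       = (\<Prod>i = 1..d. (1 + beta * (of_nat (part lam i) + of_nat d - of_nat i + 1)) ^ part lam i)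
         * (\<Sum>S \<in> SSVT d mu.
              (- beta) powi (int (num_entries mu S) - int (size_part lam))
              * (\<Prod>(i, j) \<in> diagram mu. \<Prod>r \<in> S (i, j).
                   (of_nat (part lam (d + 1 - r)) + of_nat i - of_nat j)
                   / (1 + beta * (of_nat (part lam (d + 1 - r)) + of_nat r))))
         * (\<Prod>c \<in> diagram lam. 1 / of_int (hook lam c))"
    (is "?L = ?P * ?S * ?H")
proof -
  let ?l = "part lam" and ?m = "part mu"
  let ?X = "dual_point affine d ?l"
  have mu: "length mu \<le> d" using length_le_of_diagram_subset[OF assms(3,4)] assms(5) by simp
  note cl = diagram_eq_cells[OF assms(5)] and cm = diagram_eq_cells[OF mu]
  note l = dec_part[OF assms(2), of d] and m = dec_part[OF assms(3), of d]
  have le: "?m i \<le> ?l i" if i: "i \<in> {1..d}" for i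
  proof (cases "?m i = 0")
    case False
    then have "(i, ?m i) \<in> cells d ?m" using i by auto
    then have "(i, ?m i) \<in> cells d ?l" using assms(4) unfolding cl cm by blast
    then show ?thesis by simp
  qed simp
  define R where "R v = (\<Prod>i=1..d. affine (int (v i) + int d - int i + 1)
    / affine (int (?l i) + int d - int i + 1))" for v :: "nat \<Rightarrow> nat"
  have aff: "affine (int n + int d - int i + 1) = 1 + beta * (of_nat n + of_nat d - of_nat i + 1)" for n i
    by simp
  have "?L = filling_sum (\<lambda>v. inverse (R v - 1)) d ?l ?m"
    unfolding filling_sum_def SIT_eq sit_max_def cl cm
  proof (intro sum.cong prod.cong refl arg_cong[where f = inverse] arg_cong2[where f = "(-)"])
    fix T k
    show "(\<Prod>i = 1..d. (1 + beta * (of_nat (nu_part lam mu T k i) + of_nat d - of_nat i + 1))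
        / (1 + beta * (of_nat (?l i) + of_nat d - of_nat i + 1))) = R (filled_shape d ?l ?m T k)"
      unfolding R_def aff by (intro prod.cong refl) (simp only: nu_part_eq[OF assms(5) mu])
  qed
  moreover have "filling_sum (\<lambda>v. inverse (R v - 1)) d ?l ?m * groth ?X affine d ?l = groth ?X affine d ?m"
    unfolding R_def
    by (rule filling_sum_eq_groth[where A = affine and l = ?l and m = ?m, OF affine_nonzero l _ m le])
      (rule affine_prod_ratio_neq_1)
  ultimately have main: "?L * groth ?X affine d ?l = groth ?X affine d ?m" by simp
  have b: "- beta \<noteq> 0" using beta_pos by simp
  have P: "?P = (\<Prod>i=1..d. affine (int (?l i) + int d - int i + 1) ^ ?l i)" unfolding aff ..
  have P0: "?P \<noteq> 0" 
    unfolding P prod_zero_iff[OF finite_atLeastAtMost] power_eq_0_iff using affine_nonzero by blast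
  define h where "h = (\<Prod>c\<in>diagram lam. of_int (hook lam c) :: rat poly fract)"
  have fin: "finite (diagram lam)" unfolding cl by simp
  have h: "h \<noteq> 0" unfolding h_def using fin hook_pos[OF assms(2)] by fastforce
  have H: "?H = 1 / h" by (simp add: h_def prod_dividef)
  have gl: "groth ?X affine d ?l = (- beta) ^ size_part lam * h / ?P"
    unfolding P h_def by (rule groth_diagonal_hook[OF assms(2,5)])
  \<comment> \<open>The exponent in the statement may be negative; multiplying by the full power of
    \<open>- beta\<close> turns it into the natural exponent
    \<open>num_entries mu S\<close>.\<close>
  have gm: "groth ?X affine d ?m = ?S * (- beta) ^ size_part lam"
    unfolding groth_dual_point_sum[OF mu] sum_distrib_right
    using b by (intro sum.cong refl) (simp add: power_int_diff)
  have c: "(- beta) ^ size_part lam \<noteq> 0" using b by simp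
  \<comment> \<open>Positive hooks justify the division that the multiplicative identity
    \<open>main\<close> still lacks.\<close>
  have "groth ?X affine d ?l \<noteq> 0"
    unfolding gl divide_eq_0_iff mult_eq_0_iff using c P0 h by blast
  then have "?L = groth ?X affine d ?m / groth ?X affine d ?l"
    by (rule iffD2[OF nonzero_eq_divide_eq main])
  also have "\<dots> = ?P * ?S * ?H"
  proof -
    have "s * c / (c * h / p) = p * s * (1 / h)" if "c \<noteq> 0" "h \<noteq> 0" "p \<noteq> 0" for s c p :: "rat poly fract"
      using that by (simp add: field_simps)
    from this[OF c h P0] show ?thesis unfolding gl gm H .
  qed
  finally show ?thesis .
qed

end
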